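(* Let $F:\mathbb{R}^n\rightrightarrows\mathbb{R}^n$ be upper semicontinuous with $F(x)$ compact and convex for every $x\in\mathbb{R}^n$, and suppose the system $\dot x\in F(x)$ is backward complete. Let $X_o,X_u\subset\mathbb{R}^n$ with $X_o$ closed and $X_o\cap X_u=\emptyset$. Then the system $\dot x\in F(x)$ is safe with respect to $(X_o,X_u)$ if and only if there exists a lower semicontinuous time-varying barrier function candidate $B:\mathbb{R}_{\geq0}\times\mathbb{R}^n\to\mathbb{R}$ for safety with respect to $(X_o,X_u)$, with $t\mapsto B(t,x)$ continuous for each $x\in\mathbb{R}^n$, that satisfies property $(\star\star)$.
   Context: A solution of $\dot x\in F(x)$ starting from $x_o$ is a locally absolutely continuous function $\phi:\operatorname{dom}\phi\to\mathbb{R}^n$, where $\operatorname{dom}\phi$ is $[0,T]$ or $[0,T)$ for some $T\in[0,\infty]$, with $\phi(0)=x_o$ and $\dot\phi(t)\in F(\phi(t))$ for almost all $t\in\operatorname{dom}\phi$. A solution is maximal if it cannot be extended to a solution with strictly larger domain; a system is forward complete if every maximal solution has unbounded domain. The system $\dot x\in F(x)$ is backward complete if the system $\dot x\in -F(x)$ is forward complete. The system is safe with respect to $(X_o,X_u)$ if every solution $\phi$ starting from any $x_o\in X_o$ satisfies $\phi(t)\notin X_u$ for all $t\in\operatorname{dom}\phi$. A time-varying barrier function candidate for safety with respect to $(X_o,X_u)$ is a function $B:\mathbb{R}_{\geq0}\times\mathbb{R}^n\to\mathbb{R}$ with $B(t,x)>0$ for all $(t,x)\in\mathbb{R}_{\geq0}\times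 X_u$ and $B(t,x)\le 0$ for all $(t,x)\in\mathbb{R}_{\geq0}\times X_o$. Let $K:=\{(t,x)\in\mathbb{R}_{\geq0}\times\mathbb{R}^n: B(t,x)\le 0\}$, with interior $\operatorname{int}(K)$ taken in $\mathbb{R}_{\geq0}\times\mathbb{R}^n$. Property $(\star\star)$: there is an open neighborhood $U(K)$ of $K$ such that, along each solution of $\dot x\in F(x)$ considered in the extended time–state space (i.e., along each solution of $(\dot t,\dot x)\in\{1\}\times F(x)$) starting from a point of $U(K)\setminus\operatorname{int}(K)$ and remaining in $U(K)\setminus\operatorname{int}(K)$ on a time interval, the map $t\mapsto B(t,\phi(t))$ is nonincreasing on that interval. A set-valued map $F$ is upper semicontinuous if for each $x$ and $\epsilon>0$ there is a neighborhood $U$ of $x$ with $F(y)\subset F(x)+\epsilon\mathbb{B}$ for all $y\in U$, $\mathbb{B}$ the closed unit ball. *)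

theory Defs
  imports "HOL-Analysis.Analysis"
begin

definition abs_cont_on :: "real \<Rightarrow> real \<Rightarrow> (real \<Rightarrow> 'a::real_normed_vector) \<Rightarrow> bool" where
  "abs_cont_on a b f \<longleftrightarrow>
     (\<forall>\<epsilon>>0. \<exists>\<delta>>0. \<forall>(n::nat) (l::nat \<Rightarrow> real) (r::nat \<Rightarrow> real).
        (\<forall>i<n. a \<le> l i \<and> l i \<le> r i \<and> r i \<le> b) \<and>
        (\<forall>i<n. \<forall>j<n. i \<noteq> j \<longrightarrow> r i \<le> l j \<or> r j \<le> l i) \<and>
        (\<Sum>i<n. r i - l i) < \<delta>
        \<longrightarrow> (\<Sum>i<n. norm (f (r i) - f (l i))) < \<epsilon>)"

definition loc_abs_cont_on :: "real set \<Rightarrow> (real \<Rightarrow> 'a::real_normed_vector) \<Rightarrow> bool" where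
  "loc_abs_cont_on D f \<longleftrightarrow> (\<forall>a b. a \<le> b \<and> {a..b} \<subseteq> D \<longrightarrow> abs_cont_on a b f)"

text \<open>Admissible solution domains: [0,T] with T \<in> [0,\<infinity>), [0,T) with T \<in> (0,\<infinity>),
  or [0,\<infinity>) (which covers both [0,\<infinity>] and [0,\<infinity>)).\<close>
definition sol_domain :: "real set \<Rightarrow> bool" where
  "sol_domain D \<longleftrightarrow> (\<exists>T\<ge>0. D = {0..T}) \<or> (\<exists>T>0. D = {0..<T}) \<or> D = {0..}"

definition is_solution :: "('a::euclidean_space \<Rightarrow> 'a set) \<Rightarrow> 'a \<Rightarrow> real set \<Rightarrow> (real \<Rightarrow> 'a) \<Rightarrow> bool" where
  "is_solution F x0 D \<phi> \<longleftrightarrow>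
     sol_domain D \<and> \<phi> 0 = x0 \<and> loc_abs_cont_on D \<phi> \<and>
     (AE t in lebesgue. t \<in> D \<longrightarrow>
        (\<exists>v. (\<phi> has_vector_derivative v) (at t within D) \<and> v \<in> F (\<phi> t)))"

definition is_maximal_solution :: "('a::euclidean_space \<Rightarrow> 'a set) \<Rightarrow> 'a \<Rightarrow> real set \<Rightarrow> (real \<Rightarrow> 'a) \<Rightarrow> bool" where
  "is_maximal_solution F x0 D \<phi> \<longleftrightarrow>
     is_solution F x0 D \<phi> \<and>
     \<not> (\<exists>D' \<psi>. is_solution F x0 D' \<psi> \<and> D \<subset> D' \<and> (\<forall>t\<in>D. \<psi> t = \<phi> t))"

definition forward_complete :: "('a::euclidean_space \<Rightarrow> 'a set) \<Rightarrow> bool" where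
  "forward_complete F \<longleftrightarrow>
     (\<forall>x0 D \<phi>. is_maximal_solution F x0 D \<phi> \<longrightarrow> \<not> bounded D)"

definition backward_complete :: "('a::euclidean_space \<Rightarrow> 'a set) \<Rightarrow> bool" where
  "backward_complete F \<longleftrightarrow> forward_complete (\<lambda>x. uminus ` F x)"

definition safe :: "('a::euclidean_space \<Rightarrow> 'a set) \<Rightarrow> 'a set \<Rightarrow> 'a set \<Rightarrow> bool" where
  "safe F Xo Xu \<longleftrightarrow>
     (\<forall>x0\<in>Xo. \<forall>D \<phi>. is_solution F x0 D \<phi> \<longrightarrow> (\<forall>t\<in>D. \<phi> t \<notin> Xu))"

definition usc_setvalued :: "('a::real_normed_vector \<Rightarrow> 'b::real_normed_vector set) \<Rightarrow> bool" where
  "usc_setvalued F \<longleftrightarrow>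
     (\<forall>x. \<forall>\<epsilon>>0. \<exists>U. open U \<and> x \<in> U \<and>
        (\<forall>y\<in>U. F y \<subseteq> {a + b | a b. a \<in> F x \<and> norm b \<le> \<epsilon>}))"

definition lsc_on :: "'a::topological_space set \<Rightarrow> ('a \<Rightarrow> real) \<Rightarrow> bool" where
  "lsc_on S f \<longleftrightarrow>
     (\<forall>p\<in>S. \<forall>\<epsilon>>0. \<forall>\<^sub>F q in at p within S. f p - \<epsilon> < f q)"

definition barrier_candidate :: "(real \<times> 'a \<Rightarrow> real) \<Rightarrow> 'a set \<Rightarrow> 'a set \<Rightarrow> bool" where
  "barrier_candidate B Xo Xu \<longleftrightarrow>
     (\<forall>t\<ge>0. \<forall>x\<in>Xu. B (t, x) > 0) \<and> (\<forall>t\<ge>0. \<forall>x\<in>Xo. B (t, x) \<le> 0)"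

definition ext_space :: "(real \<times> 'a) set" where
  "ext_space = {0..} \<times> UNIV"

definition sublevel_K :: "(real \<times> 'a \<Rightarrow> real) \<Rightarrow> (real \<times> 'a) set" where
  "sublevel_K B = {(t, x). t \<ge> 0 \<and> B (t, x) \<le> 0}"

definition ext_sys :: "('a \<Rightarrow> 'a set) \<Rightarrow> real \<times> 'a \<Rightarrow> (real \<times> 'a) set" where
  "ext_sys F = (\<lambda>(t, x). {1} \<times> F x)"

definition prop_starstar :: "('a::euclidean_space \<Rightarrow> 'a set) \<Rightarrow> (real \<times> 'a \<Rightarrow> real) \<Rightarrow> bool" where
  "prop_starstar F B \<longleftrightarrow>
     (\<exists>U. openin (top_of_set ext_space) U \<and> sublevel_K B \<subseteq> U \<and>
        (\<forall>p0 D \<psi> I.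
           is_solution (ext_sys F) p0 D \<psi> \<and>
           p0 \<in> U - (top_of_set ext_space) interior_of (sublevel_K B) \<and>
           is_interval I \<and> 0 \<in> I \<and> I \<subseteq> D \<and>
           (\<forall>s\<in>I. \<psi> s \<in> U - (top_of_set ext_space) interior_of (sublevel_K B))
           \<longrightarrow> (\<forall>s1\<in>I. \<forall>s2\<in>I. s1 \<le> s2 \<longrightarrow> B (\<psi> s2) \<le> B (\<psi> s1))))"

end

theory Submission
  imports Defs "HOL-Library.Diagonal_Subsequence"
begin

text \<open>If a barrier \<open>B\<close> exists and a solution goes from \<open>Xo\<close> to \<open>Xu\<close>, consider the last time at which
  it lies in the sublevel set; lower semicontinuity puts this point in the set, it is not an
  interior point, and just after it \<open>B\<close> would have to be positive and nonincreasing.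

  Conversely, let \<open>B(t, x)\<close> be the infimum of the distances to \<open>Xo\<close> of the points from which \<open>x\<close>
  can be reached within time \<open>t\<close>. Concatenation of solutions makes \<open>B\<close> nonincreasing along every
  solution in the extended space. Lower semicontinuity, and positivity on \<open>Xu\<close> for a safe system,
  come from compactness of the set of backward solutions: backward completeness prevents a
  sequence of backward solutions with convergent initial points from escaping to infinity in finite
  time, so a diagonal subsequence converges, and the limit solves the inclusion because the values
  of \<open>F\<close> are compact and convex and \<open>F\<close> is upper semicontinuous. Lipschitz limits are
  differentiable almost everywhere by a Vitali covering argument.\<close>

section \<open>Lipschitz functions are differentiable almost everywhere\<close>

text \<open>The time argument keeps the barrier lower semicontinuous: with an unlimited past, the
  arcs behind a near-minimal distance could become arbitrarily long, and their limits need not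
  connect the limit points. Bounding the elapsed time by \<open>t\<close> leaves arcs of bounded
  length, and the bound is an inequality so that \<open>Xo\<close> stays in the sublevel set at
  every time, through zero elapsed time. The obstacle is that completeness concerns each solution
  separately and gives no common bound for a sequence of solutions. A bound is therefore propagated
  in time together with the limit; the extension of the limit past a supposed blow-up time supplies
  the bound there. Derivatives are never integrated. A mean value inclusion takes the place of the
  integral: difference quotients over an interval lie in any closed convex set that contains the
  admissible velocities. It yields the speed bounds, the passage to the limit and the unit speed of
  the clock.\<close>

lemma emeasure_strict_mono_image_le:
  fixes f :: "real \<Rightarrow> real"
  assumes mono: "strict_mono f" and lip: "\<And>x y. \<bar>f x - f y\<bar> \<le> L * \<bar>x - y\<bar>"
    and E: "E \<in> sets lebesgue" and p: "p > 0"
    and small: "\<And>t d. \<lbrakk>t \<in> E; d > 0\<rbrakk> \<Longrightarrow>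
        \<exists>a b. a < b \<and> a \<le> t \<and> t \<le> b \<and> b - a < d \<and> f b - f a \<le> p * (b - a)"
  shows "emeasure lebesgue (f ` E) \<le> ennreal p * emeasure lebesgue E"
proof (rule ennreal_le_epsilon)
  fix e :: real assume "0 < e"
  \<comment> \<open>The open set \<open>T\<close> may exceed \<open>E\<close> by measure
    \<open>e / p\<close>, which the factor \<open>p\<close> turns into \<open>e\<close>. Covering
    intervals are kept inside \<open>T\<close>, so their total length is at most the measure of
    \<open>T\<close>.\<close>
  then have "0 < e / p" using p by simp
  then obtain T where T: "open T" "E \<subseteq> T" "(T - E) \<in> lmeasurable"
      "emeasure lebesgue (T - E) < ennreal (e / p)"
    using sets_lebesgue_outer_open[OF E] by blast
  define K where "K = {(a, b). a < b \<and> {a..b} \<subseteq> T \<and> f b - f a \<le> p * (b - a)}"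
  define c where "c = (\<lambda>(a::real, b). (a + b) / 2)"
  define r where "r = (\<lambda>(a::real, b). (b - a) / 2)"
  have cb: "cball (c i) (r i) = {fst i..snd i}" for i
    by (cases i) (simp add: c_def r_def cball_eq_atLeastAtMost field_simps)
  obtain C where C: "countable C" "C \<subseteq> K"
    "pairwise (\<lambda>i j. disjnt (cball (c i) (r i)) (cball (c j) (r j))) C"
    "negligible (E - (\<Union>i\<in>C. cball (c i) (r i)))"
  proof (rule Vitali_covering_theorem_cballs[of K r E c])
    show "0 < r i" if "i \<in> K" for i using that by (auto simp: K_def r_def)
    fix x d :: real assume x: "x \<in> E" "0 < d"
    obtain e where e: "e > 0" "ball x e \<subseteq> T" using T x by (meson openE subsetD)
    obtain a b where ab: "a < b" "a \<le> x" "x \<le> b" "b - a < min d e" "f b - f a \<le> p * (b - a)"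
      using small[OF x(1), of "min d e"] x e by auto
    have "{a..b} \<subseteq> ball x e" using ab by (auto simp: dist_real_def)
    then have "(a, b) \<in> K" using ab e by (auto simp: K_def)
    moreover have "x \<in> cball (c (a, b)) (r (a, b))" unfolding cb using ab by simp
    moreover have "r (a, b) < d" using ab by (simp add: r_def)
    ultimately show "\<exists>i. i \<in> K \<and> x \<in> cball (c i) (r i) \<and> r i < d" by blast
  qed blast
  define U where "U = (\<Union>i\<in>C. {fst i..snd i})"
  define V where "V = (\<Union>i\<in>C. {f (fst i)..f (snd i)})"
  have disj: "disjoint_family_on (\<lambda>i. {fst i..snd i}) C"
    using C(3) unfolding cb pairwise_def disjoint_family_on_def disjnt_def by blast
  have disjf: "disjoint_family_on (\<lambda>i. {f (fst i)..f (snd i)}) C"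
    unfolding disjoint_family_on_def
  proof (intro ballI impI)
    fix i j assume ij: "i \<in> C" "j \<in> C" "i \<noteq> j"
    then have d: "{fst i..snd i} \<inter> {fst j..snd j} = {}"
      using disj by (auto simp: disjoint_family_on_def)
    have l: "fst i < snd i" "fst j < snd j" using ij C(2) by (auto simp: K_def)
    have "snd i < fst j \<or> snd j < fst i"
    proof (rule ccontr)
      assume "\<not> ?thesis"
      then have "max (fst i) (fst j) \<in> {fst i..snd i} \<inter> {fst j..snd j}" using l by auto
      with d show False by blast
    qed
    then have "f (snd i) < f (fst j) \<or> f (snd j) < f (fst i)"
      using mono by (auto simp: strict_mono_def)
    then show "{f (fst i)..f (snd i)} \<inter> {f (fst j)..f (snd j)} = {}" by auto
  qed
  have U: "U \<in> sets lebesgue" "V \<in> sets lebesgue"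
    unfolding U_def V_def using C(1) by (auto intro!: sets.countable_UN')
  \<comment> \<open>The Vitali covering misses a null set, which a Lipschitz map sends to a null
    set.\<close>
  have "negligible (f ` (E - U))"
  proof (rule negligible_locally_Lipschitz_image)
    show "negligible (E - U)" using C(4) unfolding cb U_def .
    show "\<exists>T B. open T \<and> x \<in> T \<and> (\<forall>y\<in>(E - U) \<inter> T. norm (f y - f x) \<le> B * norm (y - x))" for x
      using lip by (intro exI[of _ UNIV] exI[of _ L]) auto
  qed simp
  then have N: "f ` (E - U) \<in> null_sets lebesgue" by (simp add: negligible_iff_null_sets)
  have "f ` E \<subseteq> f ` (E - U) \<union> V"
  proof
    fix y assume "y \<in> f ` E"
    then obtain x where x: "x \<in> E" "y = f x" by blast
    show "y \<in> f ` (E - U) \<union> V"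
    proof (cases "x \<in> U")
      case True
      then obtain i where "i \<in> C" "fst i \<le> x" "x \<le> snd i" by (auto simp: U_def)
      then have "y \<in> {f (fst i)..f (snd i)}"
        using mono x by (simp add: strict_mono_less_eq)
      then show ?thesis using \<open>i \<in> C\<close> by (auto simp: V_def)
    qed (use x in blast)
  qed
  then have "emeasure lebesgue (f ` E) \<le> emeasure lebesgue (f ` (E - U) \<union> V)"
    using N U by (intro emeasure_mono) auto
  also have "\<dots> = emeasure lebesgue V"
    using N U by (simp add: Un_commute emeasure_Un_null_set)
  also have "\<dots> = (\<integral>\<^sup>+i. emeasure lebesgue {f (fst i)..f (snd i)} \<partial>count_space C)"
    unfolding V_def using C(1) disjf by (intro emeasure_UN_countable) auto
  also have "\<dots> \<le> (\<integral>\<^sup>+i. ennreal p * emeasure lebesgue {fst i..snd i} \<partial>count_space C)"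
  proof (intro nn_integral_mono)
    fix i assume "i \<in> space (count_space C)"
    then have i: "fst i < snd i" "f (snd i) - f (fst i) \<le> p * (snd i - fst i)"
      using C(2) by (auto simp: K_def)
    then have "f (fst i) \<le> f (snd i)" using mono by (simp add: strict_mono_less_eq)
    then show "emeasure lebesgue {f (fst i)..f (snd i)} \<le> ennreal p * emeasure lebesgue {fst i..snd i}"
      using i p by (simp add: ennreal_leI flip: ennreal_mult)
  qed
  also have "\<dots> = ennreal p * (\<integral>\<^sup>+i. emeasure lebesgue {fst i..snd i} \<partial>count_space C)"
    by (simp add: nn_integral_cmult)
  also have "(\<integral>\<^sup>+i. emeasure lebesgue {fst i..snd i} \<partial>count_space C) = emeasure lebesgue U"
    unfolding U_def using C(1) disj by (intro emeasure_UN_countable[symmetric]) auto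
  also have "emeasure lebesgue U \<le> emeasure lebesgue T"
  proof (rule emeasure_mono)
    have "{fst i..snd i} \<subseteq> T" if "i \<in> C" for i
      using subsetD[OF C(2) that] by (auto simp: K_def)
    then show "U \<subseteq> T" by (auto simp: U_def)
  qed (use T(1) in simp)
  also have "emeasure lebesgue T = emeasure lebesgue E + emeasure lebesgue (T - E)"
    using T E by (subst plus_emeasure) (auto simp: Un_absorb1 fmeasurable_def)
  also have "ennreal p * (emeasure lebesgue E + emeasure lebesgue (T - E)) \<le>
      ennreal p * (emeasure lebesgue E + ennreal (e / p))"
    using T(4) by (intro mult_left_mono add_left_mono) auto
  also have "\<dots> = ennreal p * emeasure lebesgue E + ennreal e"
    using p \<open>0 < e\<close> by (simp add: distrib_left flip: ennreal_mult)
  finally show "emeasure lebesgue (f ` E) \<le> ennreal p * emeasure lebesgue E + ennreal e"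
    by (simp add: mult_left_mono)
qed

section \<open>Points at which difference quotients oscillate\<close>

definition diff_quot :: "(real \<Rightarrow> real) \<Rightarrow> real \<Rightarrow> real \<Rightarrow> real" where
  "diff_quot f t h = (f (t + h) - f t) / h"

text \<open>If \<open>p < q\<close>, no derivative exists at such a point. The scales are
  \<open>1 / real (Suc n)\<close> so that only countable intersections occur.\<close>

definition oscillation_set :: "(real \<Rightarrow> real) \<Rightarrow> real \<Rightarrow> real \<Rightarrow> real set" where
  "oscillation_set f p q =
     {t. (\<forall>n::nat. \<exists>h. h \<noteq> 0 \<and> \<bar>h\<bar> < 1 / real (Suc n) \<and> diff_quot f t h < p) \<and>
         (\<forall>n::nat. \<exists>h. h \<noteq> 0 \<and> \<bar>h\<bar> < 1 / real (Suc n) \<and> diff_quot f t h > q)}"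

text \<open>The unions over \<open>h\<close> are uncountable, but they are unions of open sets,
  because each quotient is continuous in \<open>t\<close>.\<close>

lemma oscillation_set_borel:
  assumes "continuous_on UNIV f"
  shows "oscillation_set f p q \<in> sets borel"
proof -
  have c: "continuous_on UNIV (\<lambda>t. diff_quot f t h)" if "h \<noteq> 0" for h
    unfolding diff_quot_def using that
    by (intro continuous_intros continuous_on_compose2[OF assms]) auto
  have o: "open {t. diff_quot f t h < p}" "open {t. diff_quot f t h > q}" if "h \<noteq> 0" for h
    using that c by (auto intro!: open_Collect_less continuous_intros)
  have "oscillation_set f p q =
      (\<Inter>n. \<Union>h\<in>{h. h \<noteq> 0 \<and> \<bar>h\<bar> < 1 / real (Suc n)}. {t. diff_quot f t h < p}) \<inter>
      (\<Inter>n. \<Union>h\<in>{h. h \<noteq> 0 \<and> \<bar>h\<bar> < 1 / real (Suc n)}. {t. diff_quot f t h > q})"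
    by (auto simp: oscillation_set_def)
  also have "\<dots> \<in> sets borel"
    by (intro sets.Int sets.countable_INT'' borel_open open_UN) (use o in auto)
  finally show ?thesis .
qed

text \<open>For negative \<open>h\<close> the interval is \<open>{t + h..t}\<close>, and numerator
  and denominator change sign together. The predicate \<open>P\<close> lets one lemma serve upper
  and lower bounds.\<close>

lemma small_interval_of_quotient:
  assumes "\<forall>n::nat. \<exists>h. h \<noteq> 0 \<and> \<bar>h\<bar> < 1 / real (Suc n) \<and> P (diff_quot f t h)" "d > 0"
  obtains a b where "a < b" "a \<le> t" "t \<le> b" "b - a < d" "P ((f b - f a) / (b - a))"
proof -
  obtain n where "1 / real (Suc n) < d" using assms(2) nat_approx_posE by blast
  then obtain h where h: "h \<noteq> 0" "\<bar>h\<bar> < d" "P (diff_quot f t h)"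
    using assms(1) by (meson less_trans)
  show ?thesis
  proof (cases "h > 0")
    case True
    then show ?thesis using h by (intro that[of t "t + h"]) (auto simp: diff_quot_def)
  next
    case False
    have "(f t - f (t + h)) / - h = diff_quot f t h"
      by (simp add: diff_quot_def minus_divide_right[symmetric] minus_divide_left)
    with False show ?thesis using h by (intro that[of "t + h" t]) auto
  qed
qed

text \<open>If the difference quotients at every point of \<open>E\<close> are infinitely often below \<open>p\<close> and above
  \<open>q\<close>, a Vitali covering gives \<open>|f(E)| \<le> p |E|\<close>, and the same bound for the inverse of \<open>f\<close> gives
  \<open>|E| \<le> |f(E)| / q\<close>; as \<open>p < q\<close>, \<open>E\<close> is null.\<close>

lemma oscillation_set_negligible:
  fixes f :: "real \<Rightarrow> real"
  assumes lip: "\<And>x y. \<bar>f x - f y\<bar> \<le> L * \<bar>x - y\<bar>"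
    and lower: "\<And>x y. x \<le> y \<Longrightarrow> y - x \<le> f y - f x" and pq: "0 < p" "p < q"
  shows "negligible (oscillation_set f p q)"
proof -
  have mono: "strict_mono f"
  proof (rule strict_monoI)
    fix x y :: real assume "x < y" then show "f x < f y" using lower[of x y] by simp
  qed
  have "L-lipschitz_on UNIV f"
    using lip lip[of 1 0] by (intro lipschitz_onI) (auto simp: dist_real_def)
  then have cont: "continuous_on UNIV f" by (rule lipschitz_on_continuous_on)
  have inj: "inj f" using mono by (rule strict_mono_imp_inj_on)
  have "\<exists>x. f x = y" for y
  proof -
    \<comment> \<open>Since \<open>f\<close> climbs with slope at least one, the distance from
      \<open>f 0\<close> to \<open>y\<close> is also far enough in the argument to bracket
      \<open>y\<close>.\<close>
    define c where "c = \<bar>y - f 0\<bar>"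
    have "f (- c) \<le> y" "y \<le> f c" using lower[of "- c" 0] lower[of 0 c] by (auto simp: c_def)
    then obtain x where "- c \<le> x" "x \<le> c" "f x = y"
      using IVT'[of f "-c" y c] continuous_on_subset[OF cont] by (auto simp: c_def)
    then show ?thesis by blast
  qed
  then have surj: "surj f" by (metis surjI)
  define g where "g = inv f"
  have gf: "g (f x) = x" for x by (simp add: g_def inj)
  have fg: "f (g y) = y" for y by (simp add: g_def surj surj_f_inv_f)
  have gmono: "strict_mono g"
    by (rule strict_monoI) (metis fg mono strict_mono_less)
  have glip: "\<bar>g x - g y\<bar> \<le> 1 * \<bar>x - y\<bar>" for x y
    using lower[of "g x" "g y"] lower[of "g y" "g x"] fg by (cases "g x \<le> g y") auto
  have gcont: "continuous_on UNIV g"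
    by (rule lipschitz_on_continuous_on[of 1], rule lipschitz_onI)
       (use glip in \<open>auto simp: dist_real_def\<close>)
  \<comment> \<open>Bounded pieces have finite measure; only then does a bound of the measure by
    \<open>p / q\<close> times itself force it to be zero.\<close>
  have "negligible (oscillation_set f p q \<inter> {- real n..real n})" for n
  proof -
    define E where "E = oscillation_set f p q \<inter> {- real n..real n}"
    have Eb: "E \<in> sets borel"
      unfolding E_def using oscillation_set_borel[OF cont] by simp
    then have E: "E \<in> sets lebesgue" by simp
    \<comment> \<open>As a preimage under the continuous inverse, the image is Borel.\<close>
    have "f ` E = g -` E" using gf fg by (auto simp: image_iff) (metis fg)
    also have "\<dots> \<in> sets borel"
      using measurable_sets[OF borel_measurable_continuous_onI[OF gcont] Eb] by simp
    finally have fE: "f ` E \<in> sets lebesgue" by simp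
    have 1: "emeasure lebesgue (f ` E) \<le> ennreal p * emeasure lebesgue E"
    proof (rule emeasure_strict_mono_image_le[OF mono lip E pq(1)])
      fix t d :: real assume "t \<in> E" "0 < d"
      then have "\<forall>n::nat. \<exists>h. h \<noteq> 0 \<and> \<bar>h\<bar> < 1 / real (Suc n) \<and> diff_quot f t h < p"
        by (simp add: E_def oscillation_set_def)
      from small_interval_of_quotient[where P = "\<lambda>u. u < p", OF this \<open>0 < d\<close>]
      show "\<exists>a b. a < b \<and> a \<le> t \<and> t \<le> b \<and> b - a < d \<and> f b - f a \<le> p * (b - a)"
        by (smt (verit) pos_divide_less_eq)
    qed
    have "emeasure lebesgue (g ` f ` E) \<le> ennreal (1 / q) * emeasure lebesgue (f ` E)"
    proof (rule emeasure_strict_mono_image_le[OF gmono glip fE])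
      show "0 < 1 / q" using pq by simp
      fix y d :: real assume "y \<in> f ` E" and d: "0 < d"
      then obtain t where t: "t \<in> E" "y = f t" by blast
      then have *: "\<forall>n::nat. \<exists>h. h \<noteq> 0 \<and> \<bar>h\<bar> < 1 / real (Suc n) \<and> diff_quot f t h > q"
        by (simp add: E_def oscillation_set_def)
      \<comment> \<open>An interval shorter than this has an image shorter than \<open>d\<close>,
        because \<open>f\<close> stretches by at most \<open>L\<close>. The summand 1 avoids
        division by zero.\<close>
      have d': "0 < d / (\<bar>L\<bar> + 1)" using d by (simp add: add_nonneg_pos)
      obtain a b where ab: "a < b" "a \<le> t" "t \<le> b" "b - a < d / (\<bar>L\<bar> + 1)"
          "(f b - f a) / (b - a) > q"
        using small_interval_of_quotient[where P = "\<lambda>u. u > q", OF * d'] by blast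
      have "f b - f a \<le> L * (b - a)" using lip[of b a] ab by auto
      also have "\<dots> \<le> (\<bar>L\<bar> + 1) * (b - a)" using ab by (intro mult_right_mono) auto
      also have "\<dots> < d" using ab(4) by (simp add: pos_less_divide_eq mult.commute)
      finally have "f b - f a < d" .
      moreover have "b - a \<le> 1 / q * (f b - f a)"
        using ab pq by (simp add: field_simps)
      moreover have "f a < f b" "f a \<le> f t" "f t \<le> f b"
        using mono ab by (auto simp: strict_mono_less strict_mono_less_eq)
      ultimately show "\<exists>a b. a < b \<and> a \<le> y \<and> y \<le> b \<and> b - a < d \<and> g b - g a \<le> 1 / q * (b - a)"
        using t gf by (intro exI[of _ "f a"] exI[of _ "f b"]) auto
    qed
    also have "g ` f ` E = E" by (auto simp: gf image_image)
    finally have "emeasure lebesgue E \<le> ennreal (1 / q) * (ennreal p * emeasure lebesgue E)"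
      using 1 by (meson mult_left_mono order_trans zero_le)
    also have "\<dots> = ennreal (p / q) * emeasure lebesgue E"
      using pq by (simp add: mult.assoc[symmetric] ennreal_mult[symmetric])
    finally have le: "emeasure lebesgue E \<le> ennreal (p / q) * emeasure lebesgue E" .
    have "E \<in> lmeasurable"
      unfolding E_def using oscillation_set_borel[OF cont]
      by (intro bounded_set_imp_lmeasurable) (auto intro: bounded_subset[OF bounded_closed_interval])
    then have eq: "emeasure lebesgue E = ennreal (measure lebesgue E)"
      by (simp add: emeasure_eq_measure2)
    have "measure lebesgue E \<le> p / q * measure lebesgue E"
      using le pq unfolding eq by (simp add: ennreal_mult[symmetric])
    then have "(1 - p / q) * measure lebesgue E \<le> 0" by (simp add: algebra_simps)
    moreover have "1 - p / q > 0" using pq by simp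
    ultimately have "measure lebesgue E = 0"
      by (metis measure_nonneg mult_le_0_iff not_less order_antisym)
    then show ?thesis
      using \<open>E \<in> lmeasurable\<close> by (simp add: E_def negligible_iff_measure0)
  qed
  then have "negligible (\<Union>n::nat. oscillation_set f p q \<inter> {- real n..real n})"
    by (intro negligible_Union_nat)
  moreover have "oscillation_set f p q = (\<Union>n::nat. oscillation_set f p q \<inter> {- real n..real n})"
  proof -
    have "\<exists>n::nat. - real n \<le> t \<and> t \<le> real n" for t
      using real_arch_simple[of "\<bar>t\<bar>"] by (metis abs_le_iff minus_le_iff)
    then show ?thesis by (auto simp: set_eq_iff)
  qed
  ultimately show ?thesis by simp
qed


text \<open>Rademacher's theorem on the line. The quotients are bounded, so they have a cluster
  value \<open>D\<close>; if it is not their limit, rationals \<open>p < q\<close> separate it from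
  quotients on arbitrarily small scales, which puts the point into one of countably many null
  sets.\<close>

lemma lipschitz_real_differentiable_AE:
  fixes f :: "real \<Rightarrow> real"
  assumes lip: "\<And>x y. \<bar>f x - f y\<bar> \<le> L * \<bar>x - y\<bar>"
  shows "negligible {t. \<not> f differentiable (at t)}"
proof -
  \<comment> \<open>The oscillation estimate takes functions that climb with slope at least one. The
    slope \<open>L + 1\<close> outweighs a descent of slope \<open>L\<close> by one, and a linear
    term does not affect differentiability.\<close>
  define g where "g t = f t + (L + 1) * t" for t
  have L: "0 \<le> L" using lip[of 1 0] by simp
  have glip: "\<bar>g x - g y\<bar> \<le> (2 * L + 1) * \<bar>x - y\<bar>" for x y
  proof -
    have "\<bar>g x - g y\<bar> \<le> \<bar>f x - f y\<bar> + \<bar>(L + 1) * (x - y)\<bar>"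
      by (simp add: g_def algebra_simps)
    also have "\<bar>(L + 1) * (x - y)\<bar> = (L + 1) * \<bar>x - y\<bar>" using L by (simp add: abs_mult)
    finally show ?thesis using lip[of x y] by (simp add: algebra_simps)
  qed
  have glow: "y - x \<le> g y - g x" if "x \<le> y" for x y
  proof -
    have "- (L * (y - x)) \<le> f y - f x" using lip[of y x] that by (simp add: abs_le_iff)
    then show ?thesis by (simp add: g_def algebra_simps)
  qed
  have q1: "1 \<le> diff_quot g t h" if "h \<noteq> 0" for t h
    using glow[of t "t + h"] glow[of "t + h" t] that
    by (cases "h > 0") (auto simp: diff_quot_def le_divide_eq)
  have q2: "\<bar>diff_quot g t h\<bar> \<le> 2 * L + 1" for t h
    using glip[of "t + h" t] L by (cases "h = 0") (auto simp: diff_quot_def pos_divide_le_eq)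
  define N where "N = (\<Union>(p, q)\<in>{(p, q)\<in>\<rat> \<times> \<rat>. 0 < p \<and> p < q}. oscillation_set g p q)"
  have "negligible N"
    unfolding N_def
  proof (rule negligible_countable_Union)
    have "countable {(p, q)\<in>\<rat> \<times> (\<rat>::real set). 0 < p \<and> p < q}"
      by (rule countable_subset[of _ "\<rat> \<times> \<rat>"]) (auto simp: countable_rat)
    then show "countable ((\<lambda>(p, q). oscillation_set g p q) ` {(p, q)\<in>\<rat> \<times> \<rat>. 0 < p \<and> p < q})"
      by (rule countable_image)
  qed (auto intro: oscillation_set_negligible[OF glip glow])
  moreover have "{t. \<not> f differentiable (at t)} \<subseteq> N"
  proof (rule subsetI, rule ccontr)
    fix t assume "t \<in> {t. \<not> f differentiable (at t)}" and tN: "t \<notin> N"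
    then have ndiff: "\<not> f differentiable (at t)" by simp
    define u where "u n = diff_quot g t (1 / real (Suc n))" for n
    have "bounded (range u)"
      using q2 by (intro boundedI[of _ "2 * L + 1"]) (auto simp: u_def)
    then obtain D r where r: "strict_mono r" "(u \<circ> r) \<longlonglongrightarrow> D"
      using bounded_imp_convergent_subsequence by blast
    have D1: "1 \<le> D"
      by (rule LIMSEQ_le_const[OF r(2)]) (use q1 in \<open>auto simp: u_def\<close>)
    have near: "\<exists>h. h \<noteq> 0 \<and> \<bar>h\<bar> < 1 / real (Suc n) \<and> P (diff_quot g t h)"
      if "\<forall>\<^sub>F k in sequentially. P ((u \<circ> r) k)" for n P
    proof -
      have "\<forall>\<^sub>F k in sequentially. k > n" by (rule eventually_gt_at_top)
      with that have "\<forall>\<^sub>F k in sequentially. P ((u \<circ> r) k) \<and> k > n" by (rule eventually_conj)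
      then obtain k where k: "P (u (r k))" "k > n"
        by (auto dest: eventually_happens)
      have "r k > n" using k seq_suble[OF r(1), of k] by linarith
      then have "1 / real (Suc (r k)) < 1 / real (Suc n)" by (simp add: frac_less2)
      with k show ?thesis by (intro exI[of _ "1 / real (Suc (r k))"]) (auto simp: u_def)
    qed
    have ev: "\<forall>\<^sub>F h in at 0. P h"
      if "\<And>h. h \<noteq> 0 \<Longrightarrow> \<bar>h\<bar> < 1 / real (Suc n) \<Longrightarrow> P h" for n and P :: "real \<Rightarrow> bool"
      unfolding eventually_at using that
      by (intro exI[of _ "1 / real (Suc n)"]) (auto simp: dist_real_def)
    have "((\<lambda>h. diff_quot g t h) \<longlongrightarrow> D) (at 0)"
    proof (rule order_tendstoI)
      fix a assume "D < a"
      then obtain q where q: "q \<in> \<rat>" "D < q" "q < a" using Rats_dense_in_real by blast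
      then obtain p where p: "p \<in> \<rat>" "D < p" "p < q" using Rats_dense_in_real by blast
      have "t \<notin> oscillation_set g p q" using tN p q D1 by (auto simp: N_def)
      moreover have "\<forall>n::nat. \<exists>h. h \<noteq> 0 \<and> \<bar>h\<bar> < 1 / real (Suc n) \<and> diff_quot g t h < p"
        using near[of "\<lambda>u. u < p", OF order_tendstoD(2)[OF r(2) p(2)]] by simp
      ultimately obtain n where
        "\<And>h. h \<noteq> 0 \<Longrightarrow> \<bar>h\<bar> < 1 / real (Suc n) \<Longrightarrow> \<not> q < diff_quot g t h"
        by (auto simp: oscillation_set_def)
      then show "\<forall>\<^sub>F h in at 0. diff_quot g t h < a" using q by (intro ev[of n]) force
    next
      fix a assume "a < D"
      \<comment> \<open>The null sets in \<open>N\<close> have positive \<open>p\<close>. As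
        \<open>D\<close> is at least 1, the threshold \<open>1/2\<close> leaves room for such a
        rational below \<open>D\<close>.\<close>
      then obtain p where p: "p \<in> \<rat>" "max a (1/2) < p" "p < D"
        using Rats_dense_in_real[of "max a (1/2)" D] D1 by auto
      then obtain q where q: "q \<in> \<rat>" "p < q" "q < D" using Rats_dense_in_real by blast
      have "t \<notin> oscillation_set g p q" using tN p q by (auto simp: N_def)
      moreover have "\<forall>n::nat. \<exists>h. h \<noteq> 0 \<and> \<bar>h\<bar> < 1 / real (Suc n) \<and> diff_quot g t h > q"
        using near[of "\<lambda>u. q < u", OF order_tendstoD(1)[OF r(2) q(3)]] by simp
      ultimately obtain n where
        "\<And>h. h \<noteq> 0 \<Longrightarrow> \<bar>h\<bar> < 1 / real (Suc n) \<Longrightarrow> \<not> diff_quot g t h < p"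
        by (auto simp: oscillation_set_def)
      then show "\<forall>\<^sub>F h in at 0. a < diff_quot g t h" using p by (intro ev[of n]) force
    qed
    then have "(g has_field_derivative D) (at t)"
      by (simp add: DERIV_def diff_quot_def)
    then have "((\<lambda>s. g s - (L + 1) * s) has_field_derivative D - (L + 1) * 1) (at t)"
      by (auto intro!: derivative_eq_intros)
    then have "(f has_field_derivative D - (L + 1) * 1) (at t)" by (simp add: g_def)
    with ndiff show False
      using real_differentiable_def by blast
  qed
  ultimately show ?thesis by (rule negligible_subset)
qed

lemma lipschitz_differentiable_AE:
  fixes f :: "real \<Rightarrow> 'a::euclidean_space"
  assumes lip: "\<And>x y. norm (f x - f y) \<le> L * \<bar>x - y\<bar>"
  shows "negligible {t. \<not> f differentiable (at t)}"
proof -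
  have "negligible (\<Union>i\<in>Basis. {t. \<not> (\<lambda>s. f s \<bullet> i) differentiable (at t)})"
  proof (rule negligible_countable_Union)
    show "negligible S"
      if S: "S \<in> (\<lambda>i. {t. \<not> (\<lambda>s. f s \<bullet> i) differentiable (at t)}) ` Basis" for S
    proof -
      obtain i where i: "i \<in> Basis" "S = {t. \<not> (\<lambda>s. f s \<bullet> i) differentiable (at t)}"
        using S by blast
      have "\<bar>f x \<bullet> i - f y \<bullet> i\<bar> \<le> L * \<bar>x - y\<bar>" for x y
        using Basis_le_norm[OF i(1), of "f x - f y"] lip[of x y] by (simp add: inner_diff_left)
      then show ?thesis unfolding i(2) by (rule lipschitz_real_differentiable_AE)
    qed
  qed (simp add: countable_finite)
  moreover have "{t. \<not> f differentiable (at t)} \<subseteq>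
      (\<Union>i\<in>Basis. {t. \<not> (\<lambda>s. f s \<bullet> i) differentiable (at t)})"
    using differentiable_componentwise_within[of f _ UNIV] by blast
  ultimately show ?thesis by (rule negligible_subset)
qed

section \<open>Difference quotients of absolutely continuous functions\<close>

text \<open>Both end points are compared with \<open>t\<close>; because \<open>t\<close> lies
  between them, the two errors add up to a multiple of \<open>r - l\<close>. The ball condition has
  the shape of the fineness of a tagged division.\<close>

lemma has_vector_derivative_straddle:
  fixes f :: "real \<Rightarrow> 'a::real_normed_vector"
  assumes "(f has_vector_derivative v) (at t within S)" "\<eta> > 0"
  obtains d where "d > 0"
    "\<And>l r. \<lbrakk>l \<in> S; r \<in> S; l \<le> t; t \<le> r; {l..r} \<subseteq> ball t d\<rbrakk> \<Longrightarrow>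
       norm (f r - f l - (r - l) *\<^sub>R v) \<le> \<eta> * (r - l)"
proof -
  obtain d where d: "d > 0"
    "\<And>y. y \<in> S \<Longrightarrow> norm (y - t) < d \<Longrightarrow> norm (f y - f t - (y - t) *\<^sub>R v) \<le> \<eta> * norm (y - t)"
    using assms unfolding has_vector_derivative_def has_derivative_within_alt by blast
  show ?thesis
  proof (rule that[OF d(1)])
    fix l r assume lr: "l \<in> S" "r \<in> S" "l \<le> t" "t \<le> r" "{l..r} \<subseteq> ball t d"
    then have "l \<in> {l..r}" "r \<in> {l..r}" by auto
    then have "l \<in> ball t d" "r \<in> ball t d" using lr(5) by blast+
    then have "norm (f r - f t - (r - t) *\<^sub>R v) \<le> \<eta> * norm (r - t)"
        "norm (f l - f t - (l - t) *\<^sub>R v) \<le> \<eta> * norm (l - t)"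
      using lr d(2)[of l] d(2)[of r] by (auto simp: dist_norm norm_minus_commute)
    then have *: "norm (f r - f t - (r - t) *\<^sub>R v) \<le> \<eta> * (r - t)"
        "norm (f l - f t - (l - t) *\<^sub>R v) \<le> \<eta> * (t - l)"
      using lr by auto
    have "f r - f l - (r - l) *\<^sub>R v = (f r - f t - (r - t) *\<^sub>R v) - (f l - f t - (l - t) *\<^sub>R v)"
      by (simp add: algebra_simps)
    also have "norm \<dots> \<le> norm (f r - f t - (r - t) *\<^sub>R v) + norm (f l - f t - (l - t) *\<^sub>R v)"
      by (rule norm_triangle_ineq4)
    also have "\<dots> \<le> \<eta> * (r - t) + \<eta> * (t - l)" using * by (rule add_mono)
    finally show "norm (f r - f l - (r - l) *\<^sub>R v) \<le> \<eta> * (r - l)" by (simp add: algebra_simps)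
  qed
qed

text \<open>Cousin's lemma provides a fine tagged division; the intervals tagged outside the exceptional
  null set \<open>N\<close> are controlled by the derivative, the others have small total length because the
  indicator of \<open>N\<close> has gauge integral zero, and absolute continuity controls the increments there.\<close>

lemma abs_cont_inner_increment_le:
  fixes f :: "real \<Rightarrow> 'a::real_inner"
  assumes ab: "a \<le> b" and ac: "abs_cont_on a b f" and N: "negligible N"
    and deriv: "\<And>t. t \<in> {a..b} - N \<Longrightarrow>
      \<exists>v. (f has_vector_derivative v) (at t within {a..b}) \<and> w \<bullet> v \<le> c"
  shows "w \<bullet> (f b - f a) \<le> c * (b - a)"
proof (rule field_le_epsilon)
  fix e :: real assume e: "0 < e"
  define W where "W = norm w + 1"
  have W: "W > 0" "norm w \<le> W" by (auto simp: W_def add_nonneg_pos)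
  \<comment> \<open>One third of \<open>e\<close> pays for each of three errors: the approximation
    by derivatives, the increments over intervals tagged in \<open>N\<close>, and
    \<open>\<bar>c + \<eta>\<bar>\<close> times the length of those intervals. The summand 1 keeps
    the denominator positive when \<open>a = b\<close>.\<close>
  define \<eta> where "\<eta> = e / (3 * (b - a + 1))"
  have \<eta>: "\<eta> > 0" "\<eta> * (b - a) \<le> e / 3"
    using e ab by (auto simp: \<eta>_def divide_le_eq algebra_simps)
  have "e / (3 * W) > 0" using e W by simp
  from ac[unfolded abs_cont_on_def, rule_format, OF this] obtain \<delta> where \<delta>: "\<delta> > 0" and ac': "\<forall>(n::nat) (l::nat \<Rightarrow> real) (r::nat \<Rightarrow> real).
      (\<forall>i<n. a \<le> l i \<and> l i \<le> r i \<and> r i \<le> b) \<and>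
      (\<forall>i<n. \<forall>j<n. i \<noteq> j \<longrightarrow> r i \<le> l j \<or> r j \<le> l i) \<and> (\<Sum>i<n. r i - l i) < \<delta>
      \<longrightarrow> (\<Sum>i<n. norm (f (r i) - f (l i))) < e / (3 * W)"
    by (elim exE conjE)
  define A where "A = \<bar>c + \<eta>\<bar> + 1"
  have A: "A > 0" "\<bar>c + \<eta>\<bar> \<le> A" by (auto simp: A_def)
  define \<delta>' where "\<delta>' = min \<delta> (e / (3 * A))"
  have \<delta>': "\<delta>' > 0" "\<delta>' \<le> \<delta>" "\<bar>c + \<eta>\<bar> * \<delta>' \<le> e / 3"
  proof -
    show pos: "\<delta>' > 0" "\<delta>' \<le> \<delta>" using \<delta> e A by (auto simp: \<delta>'_def)
    have "\<bar>c + \<eta>\<bar> * \<delta>' \<le> A * (e / (3 * A))"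
      using A pos by (intro mult_mono) (auto simp: \<delta>'_def)
    also have "\<dots> = e / 3" using A by simp
    finally show "\<bar>c + \<eta>\<bar> * \<delta>' \<le> e / 3" .
  qed
  have "((indicator N :: real \<Rightarrow> real) has_integral 0) {a..b}"
    using N unfolding negligible_def by (metis box_real(2))
  then obtain \<gamma> where \<gamma>: "gauge \<gamma>" and \<gamma>N: "\<And>p. \<lbrakk>p tagged_division_of {a..b}; \<gamma> fine p\<rbrakk> \<Longrightarrow>
      norm ((\<Sum>(x, k)\<in>p. measure lborel k *\<^sub>R (indicator N x :: real)) - 0) < \<delta>'"
    using \<delta>'(1) unfolding has_integral_real by meson
  have "\<exists>d>0. \<forall>l r. t \<in> {a..b} - N \<and> a \<le> l \<and> r \<le> b \<and> l \<le> t \<and> t \<le> r \<and> {l..r} \<subseteq> ball t d \<longrightarrow>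
      w \<bullet> (f r - f l) \<le> (c + \<eta>) * (r - l)" for t
  proof (cases "t \<in> {a..b} - N")
    case True
    obtain v where v: "(f has_vector_derivative v) (at t within {a..b})" "w \<bullet> v \<le> c"
      using deriv[OF True] by blast
    have "\<eta> / W > 0" using \<eta> W by simp
    from has_vector_derivative_straddle[OF v(1) this] obtain d where d: "d > 0"
      "\<And>l r. \<lbrakk>l \<in> {a..b}; r \<in> {a..b}; l \<le> t; t \<le> r; {l..r} \<subseteq> ball t d\<rbrakk> \<Longrightarrow>
       norm (f r - f l - (r - l) *\<^sub>R v) \<le> \<eta> / W * (r - l)" by blast
    have "w \<bullet> (f r - f l) \<le> (c + \<eta>) * (r - l)"
      if lr: "a \<le> l" "r \<le> b" "l \<le> t" "t \<le> r" "{l..r} \<subseteq> ball t d" for l r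
    proof -
      have "w \<bullet> (f r - f l) = (r - l) * (w \<bullet> v) + w \<bullet> (f r - f l - (r - l) *\<^sub>R v)"
        by (simp add: inner_diff_right)
      also have "w \<bullet> (f r - f l - (r - l) *\<^sub>R v) \<le> norm w * norm (f r - f l - (r - l) *\<^sub>R v)"
        by (rule norm_cauchy_schwarz)
      also have "\<dots> \<le> W * (\<eta> / W * (r - l))"
        using W lr by (intro mult_mono d(2)) auto
      also have "W * (\<eta> / W * (r - l)) = \<eta> * (r - l)" using W by simp
      also have "(r - l) * (w \<bullet> v) \<le> (r - l) * c" using v lr by (intro mult_left_mono) auto
      finally show ?thesis by (simp add: algebra_simps)
    qed
    with d(1) show ?thesis by blast
  qed (auto intro: exI[of _ 1])
  then obtain d where d: "\<And>t. d t > 0"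
    and good: "\<And>t l r. \<lbrakk>t \<in> {a..b} - N; a \<le> l; r \<le> b; l \<le> t; t \<le> r; {l..r} \<subseteq> ball t (d t)\<rbrakk> \<Longrightarrow>
      w \<bullet> (f r - f l) \<le> (c + \<eta>) * (r - l)"
    by metis
  have "gauge (\<lambda>t. \<gamma> t \<inter> ball t (d t))"
    using \<gamma> d by (intro gauge_Int gauge_ball_dependent) auto
  then obtain p where p: "p tagged_division_of {a..b}" "(\<lambda>t. \<gamma> t \<inter> ball t (d t)) fine p"
    by (rule fine_division_exists_real)
  then have fine: "\<gamma> fine p" "(\<lambda>t. ball t (d t)) fine p" by (auto simp: fine_Int)
  have k: "a \<le> Inf k" "Inf k \<le> x" "x \<le> Sup k" "Sup k \<le> b" "k = {Inf k..Sup k}"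
      "measure lborel k = Sup k - Inf k" if xk: "(x, k) \<in> p" for x k
  proof -
    obtain l r where "k = cbox l r" using tagged_division_ofD(4)[OF p(1) xk] by blast
    moreover have "x \<in> k" "k \<subseteq> {a..b}"
      using tagged_division_ofD(2,3)[OF p(1) xk] by auto
    ultimately show "a \<le> Inf k" "Inf k \<le> x" "x \<le> Sup k" "Sup k \<le> b" "k = {Inf k..Sup k}"
      "measure lborel k = Sup k - Inf k" by auto
  qed
  have fin: "finite p" using p(1) by (rule tagged_division_of_finite)
  \<comment> \<open>Degenerate intervals are left out: they carry no increment, and since their
    interior is empty, disjointness of interiors would not order their end points relative to
    another interval.\<close>
  define P where "P = {(x, k)\<in>p. x \<in> N \<and> Inf k < Sup k}"
  have Pp: "P \<subseteq> p" by (auto simp: P_def)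
  then have finP: "finite P" using fin by (rule finite_subset)
  define len where "len = (\<lambda>(x::real, k::real set). Sup k - Inf k)"
  define inc where "inc = (\<lambda>(x::real, k::real set). f (Sup k) - f (Inf k))"
  have len0: "0 \<le> len z" if "z \<in> p" for z using k(2,3)[of "fst z" "snd z"] that
    by (cases z) (auto simp: len_def)
  have lenP: "sum len P < \<delta>'"
  proof -
    have "sum len P = (\<Sum>(x, k)\<in>P. measure lborel k *\<^sub>R (indicator N x :: real))"
      using Pp k(6) by (intro sum.cong) (auto simp: len_def P_def)
    also have "\<dots> \<le> (\<Sum>(x, k)\<in>p. measure lborel k *\<^sub>R (indicator N x :: real))"
      using fin Pp by (intro sum_mono2) auto
    also have "\<dots> < \<delta>'" using \<gamma>N[OF p(1) fine(1)] by auto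
    finally show ?thesis .
  qed
  have incP: "(\<Sum>z\<in>P. norm (inc z)) < e / (3 * W)"
  proof -
    obtain h where h: "bij_betw h {..<card P} P"
      using ex_bij_betw_nat_finite[OF finP] by (auto simp: lessThan_atLeast0)
    define l where "l i = Inf (snd (h i))" for i
    define r where "r i = Sup (snd (h i))" for i
    have hP: "h i \<in> P" if "i < card P" for i using h that by (auto simp: bij_betw_def)
    have "\<forall>i<card P. a \<le> l i \<and> l i \<le> r i \<and> r i \<le> b"
    proof (intro allI impI)
      fix i assume "i < card P"
      from hP[OF this] Pp have "(fst (h i), snd (h i)) \<in> p" by auto
      from k[OF this] show "a \<le> l i \<and> l i \<le> r i \<and> r i \<le> b" by (auto simp: l_def r_def)
    qed
    moreover have "\<forall>i<card P. \<forall>j<card P. i \<noteq> j \<longrightarrow> r i \<le> l j \<or> r j \<le> l i"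
    proof (intro allI impI)
      fix i j assume ij: "i < card P" "j < card P" "i \<noteq> j"
      then have "h i \<noteq> h j" using h by (auto simp: bij_betw_def inj_on_def)
      have P: "(fst (h i), snd (h i)) \<in> P" "(fst (h j), snd (h j)) \<in> P" using hP ij by auto
      then have pp: "(fst (h i), snd (h i)) \<in> p" "(fst (h j), snd (h j)) \<in> p" using Pp by blast+
      have "interior (snd (h i)) \<inter> interior (snd (h j)) = {}"
        using tagged_division_ofD(5)[OF p(1) pp] \<open>h i \<noteq> h j\<close> by (auto simp: prod_eq_iff)
      moreover have "snd (h i) = {l i..r i}" "snd (h j) = {l j..r j}"
        using k(5)[OF pp(1)] k(5)[OF pp(2)] by (auto simp: l_def r_def)
      ultimately have disj: "{l i<..<r i} \<inter> {l j<..<r j} = {}"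
        by simp
      have lr: "l i < r i" "l j < r j" using P by (auto simp: P_def l_def r_def)
      show "r i \<le> l j \<or> r j \<le> l i"
      proof (rule ccontr)
        assume "\<not> ?thesis"
        then have "max (l i) (l j) < min (r i) (r j)" using lr by auto
        then obtain z where "max (l i) (l j) < z" "z < min (r i) (r j)" using dense by blast
        then have "z \<in> {l i<..<r i} \<inter> {l j<..<r j}" by auto
        with disj show False by blast
      qed
    qed
    moreover have "(\<Sum>i<card P. r i - l i) = sum len P"
      using sum.reindex_bij_betw[OF h, of len] by (simp add: len_def l_def r_def split_beta)
    ultimately have "(\<Sum>i<card P. norm (f (r i) - f (l i))) < e / (3 * W)"
      using lenP \<delta>'(2) by (intro ac'[rule_format]) auto
    moreover have "(\<Sum>i<card P. norm (f (r i) - f (l i))) = (\<Sum>z\<in>P. norm (inc z))"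
      using sum.reindex_bij_betw[OF h, of "\<lambda>z. norm (inc z)"]
      by (simp add: inc_def l_def r_def split_beta)
    ultimately show ?thesis by simp
  qed
  \<comment> \<open>After \<open>(c + \<eta>) * len z\<close> is subtracted, every term tagged
    outside \<open>N\<close> is nonpositive, so only the terms of \<open>P\<close> survive in the
    upper bound.\<close>
  have term_le: "w \<bullet> inc z - (c + \<eta>) * len z \<le>
      (if z \<in> P then W * norm (inc z) + \<bar>c + \<eta>\<bar> * len z else 0)" if z: "z \<in> p" for z
  proof -
    obtain x K where xK: "z = (x, K)" by (cases z)
    note kk = k[OF z[unfolded xK]]
    show ?thesis
    proof (cases "z \<in> P")
      case True
      have "w \<bullet> inc z \<le> norm w * norm (inc z)" by (rule norm_cauchy_schwarz)
      also have "\<dots> \<le> W * norm (inc z)" using W by (intro mult_right_mono) auto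
      finally have "w \<bullet> inc z \<le> W * norm (inc z)" .
      moreover have "- (c + \<eta>) * len z \<le> \<bar>c + \<eta>\<bar> * len z"
        using len0[OF z] by (rule mult_right_mono[OF abs_ge_minus_self])
      then have "- ((c + \<eta>) * len z) \<le> \<bar>c + \<eta>\<bar> * len z" by (simp only: mult_minus_left)
      ultimately show ?thesis unfolding if_P[OF True] by linarith
    next
      case False
      then consider "x \<notin> N" | "Inf K = Sup K" using z kk by (force simp: P_def xK)
      then have "w \<bullet> inc z \<le> (c + \<eta>) * len z"
      proof cases
        case 1
        have "K \<subseteq> ball x (d x)" using fine(2) z unfolding xK fine_def by blast
        then have "{Inf K..Sup K} \<subseteq> ball x (d x)" using kk(5) by simp
        with 1 kk show ?thesis
          unfolding xK inc_def len_def by (simp add: good[of x])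
      qed (simp add: xK inc_def len_def)
      with False show ?thesis by simp
    qed
  qed
  have tot: "(\<Sum>z\<in>p. inc z) = f b - f a" "sum len p = b - a"
    using additive_tagged_division_1[OF ab p(1), of f]
      additive_tagged_division_1[OF ab p(1), of "\<lambda>x. x"] by (auto simp: inc_def len_def)
  have "w \<bullet> (f b - f a) - (c + \<eta>) * (b - a) = (\<Sum>z\<in>p. w \<bullet> inc z - (c + \<eta>) * len z)"
    by (simp add: tot[symmetric] inner_sum_right sum_subtractf sum_distrib_left)
  also have "\<dots> \<le> (\<Sum>z\<in>p. if z \<in> P then W * norm (inc z) + \<bar>c + \<eta>\<bar> * len z else 0)"
    using term_le by (rule sum_mono)
  also have "\<dots> = (\<Sum>z\<in>P. W * norm (inc z) + \<bar>c + \<eta>\<bar> * len z)"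
    using fin Pp by (simp add: sum.If_cases Int_absorb1)
  also have "\<dots> = W * (\<Sum>z\<in>P. norm (inc z)) + \<bar>c + \<eta>\<bar> * sum len P"
    by (simp add: sum.distrib sum_distrib_left)
  also have "W * (\<Sum>z\<in>P. norm (inc z)) \<le> W * (e / (3 * W))"
    using incP W by (intro mult_left_mono) auto
  also have "\<bar>c + \<eta>\<bar> * sum len P \<le> \<bar>c + \<eta>\<bar> * \<delta>'"
    using lenP by (intro mult_left_mono) auto
  also have "W * (e / (3 * W)) = e / 3" using W by simp
  finally show "w \<bullet> (f b - f a) \<le> c * (b - a) + e"
    using \<delta>'(3) \<eta>(2) by (simp add: algebra_simps)
qed

text \<open>If the quotient were outside \<open>C\<close>, a separating hyperplane would put it
  strictly on one side and all derivatives on the other; the scalar increment estimate in the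
  direction \<open>- w\<close> rules this out.\<close>

lemma abs_cont_difference_quotient_in_convex:
  fixes f :: "real \<Rightarrow> 'a::euclidean_space"
  assumes ab: "a < b" and ac: "abs_cont_on a b f" and N: "negligible N"
    and C: "closed C" "convex C"
    and deriv: "\<And>t. t \<in> {a..b} - N \<Longrightarrow>
      \<exists>v. (f has_vector_derivative v) (at t within {a..b}) \<and> v \<in> C"
  shows "(f b - f a) /\<^sub>R (b - a) \<in> C"
proof (rule ccontr)
  assume "(f b - f a) /\<^sub>R (b - a) \<notin> C"
  then obtain w c where w: "w \<bullet> ((f b - f a) /\<^sub>R (b - a)) < c" "\<And>x. x \<in> C \<Longrightarrow> w \<bullet> x > c"
    using separating_hyperplane_closed_point[OF C(2,1)] by blast
  have "(- w) \<bullet> (f b - f a) \<le> - c * (b - a)"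
    using ab w(2) deriv
    by (intro abs_cont_inner_increment_le[OF _ ac N]) (force intro: less_imp_le)+
  then have "c * (b - a) \<le> w \<bullet> (f b - f a)" by simp
  then have "c \<le> w \<bullet> ((f b - f a) /\<^sub>R (b - a))"
    using ab by (simp add: pos_le_divide_eq divide_inverse_commute[symmetric])
  with w(1) show False by simp
qed

section \<open>Absolute continuity and solutions\<close>

lemma abs_cont_onI:
  assumes "\<And>\<epsilon>. \<epsilon> > 0 \<Longrightarrow> \<exists>\<delta>>0. \<forall>(n::nat) (l::nat \<Rightarrow> real) (r::nat \<Rightarrow> real).
        (\<forall>i<n. a \<le> l i \<and> l i \<le> r i \<and> r i \<le> b) \<longrightarrow>
        (\<forall>i<n. \<forall>j<n. i \<noteq> j \<longrightarrow> r i \<le> l j \<or> r j \<le> l i) \<longrightarrow>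
        (\<Sum>i<n. r i - l i) < \<delta>
        \<longrightarrow> (\<Sum>i<n. norm (f (r i) - f (l i))) < \<epsilon>"
  shows "abs_cont_on a b f"
  unfolding abs_cont_on_def imp_conjL by (intro allI impI assms)

lemma abs_cont_onE:
  assumes "abs_cont_on a b f" "\<epsilon> > 0"
  obtains \<delta> where "\<delta> > 0"
    "\<And>(n::nat) (l::nat \<Rightarrow> real) (r::nat \<Rightarrow> real).
        (\<And>i. i < n \<Longrightarrow> a \<le> l i \<and> l i \<le> r i \<and> r i \<le> b) \<Longrightarrow>
        (\<And>i j. i < n \<Longrightarrow> j < n \<Longrightarrow> i \<noteq> j \<Longrightarrow> r i \<le> l j \<or> r j \<le> l i) \<Longrightarrow>
        (\<Sum>i<n. r i - l i) < \<delta>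
        \<Longrightarrow> (\<Sum>i<n. norm (f (r i) - f (l i))) < \<epsilon>"
proof -
  from assms(1)[unfolded abs_cont_on_def, rule_format, OF assms(2)] obtain \<delta> where
    "\<delta> > 0" and \<delta>: "\<forall>(n::nat) (l::nat \<Rightarrow> real) (r::nat \<Rightarrow> real).
        (\<forall>i<n. a \<le> l i \<and> l i \<le> r i \<and> r i \<le> b) \<and>
        (\<forall>i<n. \<forall>j<n. i \<noteq> j \<longrightarrow> r i \<le> l j \<or> r j \<le> l i) \<and>
        (\<Sum>i<n. r i - l i) < \<delta>
        \<longrightarrow> (\<Sum>i<n. norm (f (r i) - f (l i))) < \<epsilon>"
    by (elim exE conjE)
  show ?thesis by (rule that[OF \<open>\<delta> > 0\<close>], rule \<delta>[rule_format]) auto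
qed

lemma abs_cont_on_subinterval:
  assumes "abs_cont_on a b f" "a \<le> c" "d \<le> b"
  shows "abs_cont_on c d f"
proof (rule abs_cont_onI)
  fix \<epsilon> :: real assume "\<epsilon> > 0"
  with assms(1) obtain \<delta> where d: "\<delta> > 0"
    "\<And>(n::nat) l r. (\<And>i. i < n \<Longrightarrow> a \<le> l i \<and> l i \<le> r i \<and> r i \<le> b) \<Longrightarrow>
        (\<And>i j. i < n \<Longrightarrow> j < n \<Longrightarrow> i \<noteq> j \<Longrightarrow> r i \<le> l j \<or> r j \<le> l i) \<Longrightarrow>
        (\<Sum>i<n. r i - l i) < \<delta> \<Longrightarrow> (\<Sum>i<n. norm (f (r i) - f (l i))) < \<epsilon>"
    by (rule abs_cont_onE) blast
  show "\<exists>\<delta>>0. \<forall>(n::nat) l r. (\<forall>i<n. c \<le> l i \<and> l i \<le> r i \<and> r i \<le> d) \<longrightarrow>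
        (\<forall>i<n. \<forall>j<n. i \<noteq> j \<longrightarrow> r i \<le> l j \<or> r j \<le> l i) \<longrightarrow>
        (\<Sum>i<n. r i - l i) < \<delta> \<longrightarrow> (\<Sum>i<n. norm (f (r i) - f (l i))) < \<epsilon>"
    using d(1) assms(2,3)
    by (intro exI[of _ \<delta>] conjI allI impI d(2)) (auto intro: order_trans)
qed

text \<open>One transfer principle behind most closure properties below. A monotone nonexpansive
  \<open>\<sigma>\<close> maps nonoverlapping intervals to nonoverlapping intervals of no larger
  total length, and the term with \<open>K\<close> absorbs a Lipschitz part. Maximum and minimum
  allow \<open>\<sigma>\<close> to reverse the order, as time reversal does.\<close>

lemma abs_cont_on_compose:
  fixes f :: "real \<Rightarrow> 'a::real_normed_vector" and g :: "real \<Rightarrow> 'b::real_normed_vector"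
  assumes "abs_cont_on a b f"
    and le: "\<And>l r. \<lbrakk>c \<le> l; l \<le> r; r \<le> d\<rbrakk> \<Longrightarrow>
      norm (g r - g l) \<le> K * (r - l) + norm (f (max (\<sigma> l) (\<sigma> r)) - f (min (\<sigma> l) (\<sigma> r)))"
    and \<sigma>: "\<And>t. t \<in> {c..d} \<Longrightarrow> \<sigma> t \<in> {a..b}"
      "\<And>l r. \<lbrakk>c \<le> l; l \<le> r; r \<le> d\<rbrakk> \<Longrightarrow> \<bar>\<sigma> r - \<sigma> l\<bar> \<le> r - l"
      "mono_on {c..d} \<sigma> \<or> antimono_on {c..d} \<sigma>"
  shows "abs_cont_on c d g"
proof (rule abs_cont_onI)
  fix \<epsilon> :: real assume e: "\<epsilon> > 0"
  then have "\<epsilon> / 2 > 0" by simp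
  with assms(1) obtain \<delta> where \<delta>: "\<delta> > 0"
    "\<And>(n::nat) l r. (\<And>i. i < n \<Longrightarrow> a \<le> l i \<and> l i \<le> r i \<and> r i \<le> b) \<Longrightarrow>
        (\<And>i j. i < n \<Longrightarrow> j < n \<Longrightarrow> i \<noteq> j \<Longrightarrow> r i \<le> l j \<or> r j \<le> l i) \<Longrightarrow>
        (\<Sum>i<n. r i - l i) < \<delta> \<Longrightarrow> (\<Sum>i<n. norm (f (r i) - f (l i))) < \<epsilon> / 2"
    by (rule abs_cont_onE) blast
  define A where "A = \<bar>K\<bar> + 1"
  have A: "A > 0" "K \<le> A" by (auto simp: A_def)
  show "\<exists>\<delta>>0. \<forall>(n::nat) l r. (\<forall>i<n. c \<le> l i \<and> l i \<le> r i \<and> r i \<le> d) \<longrightarrow>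
        (\<forall>i<n. \<forall>j<n. i \<noteq> j \<longrightarrow> r i \<le> l j \<or> r j \<le> l i) \<longrightarrow>
        (\<Sum>i<n. r i - l i) < \<delta> \<longrightarrow> (\<Sum>i<n. norm (g (r i) - g (l i))) < \<epsilon>"
  proof (intro exI[of _ "min \<delta> (\<epsilon> / (2 * A))"] conjI allI impI)
    show "0 < min \<delta> (\<epsilon> / (2 * A))" using \<delta>(1) e A by auto
    fix n :: nat and l r :: "nat \<Rightarrow> real"
    assume lr: "\<forall>i<n. c \<le> l i \<and> l i \<le> r i \<and> r i \<le> d"
      and dis: "\<forall>i<n. \<forall>j<n. i \<noteq> j \<longrightarrow> r i \<le> l j \<or> r j \<le> l i"
      and sum: "(\<Sum>i<n. r i - l i) < min \<delta> (\<epsilon> / (2 * A))"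
    define l' where "l' i = min (\<sigma> (l i)) (\<sigma> (r i))" for i
    define r' where "r' i = max (\<sigma> (l i)) (\<sigma> (r i))" for i
    have "(\<Sum>i<n. norm (f (r' i) - f (l' i))) < \<epsilon> / 2"
    proof (rule \<delta>(2))
      fix i assume i: "i < n"
      have "l i \<in> {c..d}" "r i \<in> {c..d}" using lr[rule_format, OF i] by auto
      then have "\<sigma> (l i) \<in> {a..b}" "\<sigma> (r i) \<in> {a..b}" by (auto intro!: \<sigma>(1) simp del: atLeastAtMost_iff)
      then show "a \<le> l' i \<and> l' i \<le> r' i \<and> r' i \<le> b" by (auto simp: l'_def r'_def)
    next
      fix i j assume ij: "i < n" "j < n" "i \<noteq> j"
      have i: "c \<le> l i" "l i \<le> r i" "r i \<le> d" "c \<le> l j" "l j \<le> r j" "r j \<le> d"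
        using lr ij by auto
      from \<sigma>(3) show "r' i \<le> l' j \<or> r' j \<le> l' i"
      proof
        assume m: "mono_on {c..d} \<sigma>"
        have "\<sigma> (l i) \<le> \<sigma> (r i)" "\<sigma> (l j) \<le> \<sigma> (r j)"
          using i by (auto intro!: mono_onD[OF m])
        moreover have "\<sigma> (r i) \<le> \<sigma> (l j) \<or> \<sigma> (r j) \<le> \<sigma> (l i)"
          using dis[rule_format, OF ij] i by (auto intro!: mono_onD[OF m])
        ultimately show ?thesis by (auto simp: l'_def r'_def)
      next
        assume m: "antimono_on {c..d} \<sigma>"
        have "\<sigma> (l i) \<ge> \<sigma> (r i)" "\<sigma> (l j) \<ge> \<sigma> (r j)"
          using i by (auto intro!: monotone_onD[OF m])
        moreover have "\<sigma> (r i) \<ge> \<sigma> (l j) \<or> \<sigma> (r j) \<ge> \<sigma> (l i)"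
          using dis[rule_format, OF ij] i by (auto intro!: monotone_onD[OF m])
        ultimately show ?thesis by (auto simp: l'_def r'_def)
      qed
    next
      have "(\<Sum>i<n. r' i - l' i) \<le> (\<Sum>i<n. r i - l i)"
      proof (rule sum_mono)
        fix i assume "i \<in> {..<n}"
        then have "\<bar>\<sigma> (r i) - \<sigma> (l i)\<bar> \<le> r i - l i" using lr \<sigma>(2) by auto
        then show "r' i - l' i \<le> r i - l i" by (auto simp: l'_def r'_def)
      qed
      with sum show "(\<Sum>i<n. r' i - l' i) < \<delta>" by simp
    qed
    moreover have "(\<Sum>i<n. norm (g (r i) - g (l i))) \<le>
        (\<Sum>i<n. A * (r i - l i) + norm (f (r' i) - f (l' i)))"
    proof (rule sum_mono)
      fix i assume "i \<in> {..<n}"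
      then have i: "c \<le> l i" "l i \<le> r i" "r i \<le> d" using lr by auto
      have "K * (r i - l i) \<le> A * (r i - l i)" using A i by (intro mult_right_mono) auto
      with le[OF i] show "norm (g (r i) - g (l i)) \<le> A * (r i - l i) + norm (f (r' i) - f (l' i))"
        by (simp add: l'_def r'_def)
    qed
    moreover have "A * (\<Sum>i<n. r i - l i) < \<epsilon> / 2"
      using sum A by (simp add: field_simps)
    ultimately show "(\<Sum>i<n. norm (g (r i) - g (l i))) < \<epsilon>"
      by (simp add: sum.distrib sum_distrib_left)
  qed
qed

lemma abs_cont_on_const: "abs_cont_on a b (\<lambda>_. c)"
  by (rule abs_cont_onI) (auto intro: exI[of _ "1::real"])

lemma abs_cont_on_lipschitz:
  assumes "\<And>l r. \<lbrakk>a \<le> l; l \<le> r; r \<le> b\<rbrakk> \<Longrightarrow> norm (f r - f l) \<le> K * (r - l)"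
  shows "abs_cont_on a b f"
  by (rule abs_cont_on_compose[where \<sigma> = "\<lambda>x. x" and K = K,
        OF abs_cont_on_const[of a b "0::real"]])
     (use assms in \<open>simp_all add: mono_on_def\<close>)

lemma abs_cont_on_cong:
  assumes "abs_cont_on a b f" "\<And>t. t \<in> {a..b} \<Longrightarrow> g t = f t"
  shows "abs_cont_on a b g"
  by (rule abs_cont_on_compose[where \<sigma> = "\<lambda>x. x" and K = 0, OF assms(1)])
     (use assms(2) in \<open>simp_all add: mono_on_def max_absorb2 min_absorb1\<close>)

lemma abs_cont_on_shift:
  assumes "abs_cont_on (a + c) (b + c) f"
  shows "abs_cont_on a b (\<lambda>t. f (t + c))"
  by (rule abs_cont_on_compose[where \<sigma> = "\<lambda>t. t + c" and K = 0, OF assms])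
     (simp_all add: mono_on_def max_absorb2 min_absorb1)

lemma abs_cont_on_reflect:
  assumes "abs_cont_on a b f"
  shows "abs_cont_on (c - b) (c - a) (\<lambda>t. f (c - t))"
  by (rule abs_cont_on_compose[where \<sigma> = "\<lambda>t. c - t" and K = 0, OF assms])
     (simp_all add: monotone_on_def max_absorb1 min_absorb2 norm_minus_commute)

lemma abs_cont_on_add:
  assumes f: "abs_cont_on a b f" and g: "abs_cont_on a b g"
  shows "abs_cont_on a b (\<lambda>t. f t + g t)"
proof (rule abs_cont_onI)
  fix \<epsilon> :: real assume "\<epsilon> > 0"
  then have e: "\<epsilon> / 2 > 0" by simp
  from f e obtain \<delta>1 where d1: "\<delta>1 > 0"
    "\<And>(n::nat) l r. (\<And>i. i < n \<Longrightarrow> a \<le> l i \<and> l i \<le> r i \<and> r i \<le> b) \<Longrightarrow>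
        (\<And>i j. i < n \<Longrightarrow> j < n \<Longrightarrow> i \<noteq> j \<Longrightarrow> r i \<le> l j \<or> r j \<le> l i) \<Longrightarrow>
        (\<Sum>i<n. r i - l i) < \<delta>1 \<Longrightarrow> (\<Sum>i<n. norm (f (r i) - f (l i))) < \<epsilon> / 2"
    by (rule abs_cont_onE) blast
  from g e obtain \<delta>2 where d2: "\<delta>2 > 0"
    "\<And>(n::nat) l r. (\<And>i. i < n \<Longrightarrow> a \<le> l i \<and> l i \<le> r i \<and> r i \<le> b) \<Longrightarrow>
        (\<And>i j. i < n \<Longrightarrow> j < n \<Longrightarrow> i \<noteq> j \<Longrightarrow> r i \<le> l j \<or> r j \<le> l i) \<Longrightarrow>
        (\<Sum>i<n. r i - l i) < \<delta>2 \<Longrightarrow> (\<Sum>i<n. norm (g (r i) - g (l i))) < \<epsilon> / 2"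
    by (rule abs_cont_onE) blast
  show "\<exists>\<delta>>0. \<forall>(n::nat) l r. (\<forall>i<n. a \<le> l i \<and> l i \<le> r i \<and> r i \<le> b) \<longrightarrow>
        (\<forall>i<n. \<forall>j<n. i \<noteq> j \<longrightarrow> r i \<le> l j \<or> r j \<le> l i) \<longrightarrow>
        (\<Sum>i<n. r i - l i) < \<delta> \<longrightarrow> (\<Sum>i<n. norm (f (r i) + g (r i) - (f (l i) + g (l i)))) < \<epsilon>"
  proof (intro exI[of _ "min \<delta>1 \<delta>2"] conjI allI impI)
    show "0 < min \<delta>1 \<delta>2" using d1 d2 by simp
    fix n :: nat and l r :: "nat \<Rightarrow> real"
    assume lr: "\<forall>i<n. a \<le> l i \<and> l i \<le> r i \<and> r i \<le> b"
      and dis: "\<forall>i<n. \<forall>j<n. i \<noteq> j \<longrightarrow> r i \<le> l j \<or> r j \<le> l i"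
      and sum: "(\<Sum>i<n. r i - l i) < min \<delta>1 \<delta>2"
    have "(\<Sum>i<n. norm (f (r i) + g (r i) - (f (l i) + g (l i)))) \<le>
        (\<Sum>i<n. norm (f (r i) - f (l i)) + norm (g (r i) - g (l i)))"
      by (intro sum_mono) (metis add_diff_add norm_triangle_ineq)
    also have "\<dots> < \<epsilon> / 2 + \<epsilon> / 2"
      unfolding sum.distrib using lr dis sum by (intro add_strict_mono d1(2) d2(2)) auto
    finally show "(\<Sum>i<n. norm (f (r i) + g (r i) - (f (l i) + g (l i)))) < \<epsilon>" by simp
  qed
qed

text \<open>On the joined interval \<open>f t\<close> equals
  \<open>f (min t b) + f (max t b) - f b\<close>. Clamping at \<open>b\<close> is monotone and
  nonexpansive, so no interval has to be split at \<open>b\<close>.\<close>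

lemma abs_cont_on_join:
  fixes f :: "real \<Rightarrow> 'a::real_normed_vector"
  assumes f: "abs_cont_on a b f" and g: "abs_cont_on b c f" and abc: "a \<le> b" "b \<le> c"
  shows "abs_cont_on a c f"
proof -
  have "abs_cont_on a c (\<lambda>t. f (min t b))"
    using abc by (intro abs_cont_on_compose[where \<sigma> = "\<lambda>t. min t b" and K = 0, OF f])
      (auto simp: mono_on_def max_def min_def)
  moreover have "abs_cont_on a c (\<lambda>t. f (max t b))"
    using abc by (intro abs_cont_on_compose[where \<sigma> = "\<lambda>t. max t b" and K = 0, OF g])
      (auto simp: mono_on_def max_def min_def)
  ultimately have "abs_cont_on a c (\<lambda>t. f (min t b) + f (max t b))" by (rule abs_cont_on_add)
  then have "abs_cont_on a c (\<lambda>t. f (min t b) + f (max t b) + - f b)"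
    by (rule abs_cont_on_add) (rule abs_cont_on_const)
  then show ?thesis by (rule abs_cont_on_cong) (auto simp: max_def min_def)
qed

lemma abs_cont_on_imp_continuous_on:
  assumes "abs_cont_on a b f"
  shows "continuous_on {a..b} f"
  unfolding continuous_on_iff
proof (intro ballI allI impI)
  fix x e :: real assume x: "x \<in> {a..b}" and "0 < e"
  from assms \<open>0 < e\<close> obtain \<delta> where d: "\<delta> > 0"
    "\<And>(n::nat) l r. (\<And>i. i < n \<Longrightarrow> a \<le> l i \<and> l i \<le> r i \<and> r i \<le> b) \<Longrightarrow>
        (\<And>i j. i < n \<Longrightarrow> j < n \<Longrightarrow> i \<noteq> j \<Longrightarrow> r i \<le> l j \<or> r j \<le> l i) \<Longrightarrow>
        (\<Sum>i<n. r i - l i) < \<delta> \<Longrightarrow> (\<Sum>i<n. norm (f (r i) - f (l i))) < e"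
    by (rule abs_cont_onE) blast
  have "dist (f y) (f x) < e" if y: "y \<in> {a..b}" "dist y x < \<delta>" for y
  proof -
    have "(\<Sum>i<1::nat. norm (f (max x y) - f (min x y))) < e"
      by (rule d(2)[of 1]) (use x y in \<open>auto simp: dist_real_def\<close>)
    then show ?thesis by (auto simp: dist_norm max_def min_def norm_minus_commute split: if_splits)
  qed
  then show "\<exists>d>0. \<forall>y\<in>{a..b}. dist y x < d \<longrightarrow> dist (f y) (f x) < e" using d(1) by blast
qed

text \<open>The three explicit shapes are awkward for unions of chains of domains; being an interval
  in the half-line that contains 0 passes to such unions directly.\<close>

lemma sol_domain_iff: "sol_domain D \<longleftrightarrow> 0 \<in> D \<and> D \<subseteq> {0..} \<and> is_interval D"
proof
  assume "sol_domain D"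
  then show "0 \<in> D \<and> D \<subseteq> {0..} \<and> is_interval D"
    by (auto simp: sol_domain_def is_interval_cc is_interval_co is_interval_ci)
next
  assume D: "0 \<in> D \<and> D \<subseteq> {0..} \<and> is_interval D"
  then have mem: "x \<in> D" if "0 \<le> x" "x \<le> y" "y \<in> D" for x y
    using that by (meson mem_is_interval_1_I)
  show "sol_domain D"
  proof (cases "bdd_above D")
    case True
    have up: "x \<le> Sup D" if "x \<in> D" for x using True that by (rule cSup_upper[rotated])
    have lt: "x \<in> D" if "0 \<le> x" "x < Sup D" for x
      using that D mem by (metis empty_iff less_cSupD less_imp_le)
    show ?thesis
    proof (cases "Sup D \<in> D")
      case True
      then have "D = {0..Sup D}" using D up by (auto intro: mem[OF _ _ True])
      moreover have "0 \<le> Sup D" using up D by blast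
      ultimately show ?thesis unfolding sol_domain_def by blast
    next
      case False
      have less: "x < Sup D" if "x \<in> D" for x
        using up[OF that] False that by (cases "x = Sup D") auto
      have "D = {0..<Sup D}" using D less lt by auto
      moreover have "0 < Sup D" using less D by blast
      ultimately show ?thesis unfolding sol_domain_def by blast
    qed
  next
    case False
    have "x \<in> D" if "0 \<le> x" for x
      using False mem[OF that] unfolding bdd_above_def by (meson linear)
    then have "D = {0..}" using D by auto
    then show ?thesis by (simp add: sol_domain_def)
  qed
qed

lemma sol_domain_Icc_subset:
  assumes "sol_domain D" "T \<in> D"
  shows "0 \<le> T" "{0..T} \<subseteq> D"
  using assms by (auto simp: sol_domain_def)

text \<open>A solution on a compact interval with arbitrary starting time. The derivative is
  two-sided and asked for in the open interval only: the end points are null anyway, and the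
  condition becomes local, which suits cutting, gluing, translation and reversal.\<close>

definition trajectory :: "('a::euclidean_space \<Rightarrow> 'a set) \<Rightarrow> real \<Rightarrow> real \<Rightarrow> (real \<Rightarrow> 'a) \<Rightarrow> bool" where
  "trajectory F a b \<phi> \<longleftrightarrow> abs_cont_on a b \<phi> \<and>
     (\<exists>N. negligible N \<and>
        (\<forall>t\<in>{a<..<b} - N. \<exists>v. (\<phi> has_vector_derivative v) (at t) \<and> v \<in> F (\<phi> t)))"

lemma is_solution_iff_trajectory:
  "is_solution F x0 D \<phi> \<longleftrightarrow> sol_domain D \<and> \<phi> 0 = x0 \<and> (\<forall>T\<in>D. trajectory F 0 T \<phi>)"
proof -
  let ?P = "\<lambda>t. \<exists>v. (\<phi> has_vector_derivative v) (at t) \<and> v \<in> F (\<phi> t)"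
  let ?Q = "\<lambda>t. \<exists>v. (\<phi> has_vector_derivative v) (at t within D) \<and> v \<in> F (\<phi> t)"
  have PQ: "?P t = ?Q t" if "t \<in> interior D" for t
    using at_within_interior[OF that] by simp
  show ?thesis
  proof (cases "sol_domain D")
    case True
    then have D: "0 \<in> D" "D \<subseteq> {0..}" "is_interval D" by (auto simp: sol_domain_iff)
    have sub: "{0..T} \<subseteq> D" if "T \<in> D" for T
      using True that by (rule sol_domain_Icc_subset)
    have "loc_abs_cont_on D \<phi> \<longleftrightarrow> (\<forall>T\<in>D. abs_cont_on 0 T \<phi>)"
    proof
      assume "loc_abs_cont_on D \<phi>"
      then show "\<forall>T\<in>D. abs_cont_on 0 T \<phi>" using sub D by (auto simp: loc_abs_cont_on_def)
    next
      assume R: "\<forall>T\<in>D. abs_cont_on 0 T \<phi>"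
      show "loc_abs_cont_on D \<phi>"
        unfolding loc_abs_cont_on_def
      proof (intro allI impI)
        fix a b assume ab: "a \<le> b \<and> {a..b} \<subseteq> D"
        then have "a \<in> D" "b \<in> D" by auto
        then have "abs_cont_on 0 b \<phi>" "0 \<le> a" using R D(2) by auto
        then show "abs_cont_on a b \<phi>" by (rule abs_cont_on_subinterval) simp
      qed
    qed
    moreover have "(AE t in lebesgue. t \<in> D \<longrightarrow> ?Q t) \<longleftrightarrow>
        (\<forall>T\<in>D. \<exists>N. negligible N \<and> (\<forall>t\<in>{0<..<T} - N. ?P t))"
    proof
      assume "AE t in lebesgue. t \<in> D \<longrightarrow> ?Q t"
      then obtain N where N: "N \<in> null_sets lebesgue" "{t \<in> space lebesgue. \<not> (t \<in> D \<longrightarrow> ?Q t)} \<subseteq> N"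
        unfolding eventually_ae_filter by blast
      then have N': "?Q t" if "t \<in> D" "t \<notin> N" for t using that by auto
      have "?P t" if "t \<in> {0<..<T} - N" "T \<in> D" for t T
      proof -
        have "{0<..<T} \<subseteq> D" using sub[OF that(2)] by auto
        then have "t \<in> interior D" using that by (meson DiffD1 interior_maximal open_greaterThanLessThan subsetD)
        moreover have "?Q t" using that \<open>{0<..<T} \<subseteq> D\<close> by (intro N') auto
        ultimately show ?thesis using PQ by blast
      qed
      then show "\<forall>T\<in>D. \<exists>N. negligible N \<and> (\<forall>t\<in>{0<..<T} - N. ?P t)"
        using N(1) by (auto simp: negligible_iff_null_sets intro!: exI[of _ N])
    next
      assume "\<forall>T\<in>D. \<exists>N. negligible N \<and> (\<forall>t\<in>{0<..<T} - N. ?P t)"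
      then obtain N where N: "\<And>T. T \<in> D \<Longrightarrow> negligible (N T)"
          "\<And>T t. T \<in> D \<Longrightarrow> t \<in> {0<..<T} - N T \<Longrightarrow> ?P t"
        by metis
      \<comment> \<open>The exceptional set depends on the horizon. Each interior point of
        \<open>D\<close> lies below a rational horizon in \<open>D\<close>, so countably many of
        these sets suffice; the frontier, where the derivative within \<open>D\<close> can be
        one-sided, is null because \<open>D\<close> is convex.\<close>
      define Z where "Z = frontier D \<union> (\<Union>q\<in>\<rat> \<inter> D. N q)"
      have "negligible Z"
        unfolding Z_def
      proof (intro negligible_Un negligible_countable_Union)
        show "negligible (frontier D)"
          using D(3) by (intro negligible_convex_frontier) (simp add: is_interval_convex_1)
        show "countable (N ` (\<rat> \<inter> D))" by (simp add: countable_rat)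
      qed (use N in auto)
      moreover have "?Q t" if t: "t \<in> D" "t \<notin> Z" for t
      proof -
        have ti: "t \<in> interior D"
          using t closure_subset by (fastforce simp: Z_def frontier_def)
        then obtain e where e: "e > 0" "ball t e \<subseteq> D" by (auto simp: mem_interior)
        obtain q where q: "q \<in> \<rat>" "t < q" "q < t + e"
          using Rats_dense_in_real[of t "t + e"] e by auto
        have "q \<in> D" using e q by (auto simp: dist_real_def intro!: subsetD[OF e(2)])
        moreover have "0 < t"
        proof -
          have "t - e / 2 \<in> ball t e" using e by (simp add: dist_real_def)
          then have "t - e / 2 \<in> D" using e(2) by blast
          then show ?thesis using D(2) e(1) by force
        qed
        ultimately have "?P t" using q t by (intro N(2)[of q]) (auto simp: Z_def)
        with PQ[OF ti] show ?thesis by simp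
      qed
      ultimately show "AE t in lebesgue. t \<in> D \<longrightarrow> ?Q t"
        by (intro AE_I'[of Z]) (auto simp: negligible_iff_null_sets)
    qed
    ultimately show ?thesis
      using True unfolding is_solution_def trajectory_def by blast
  qed (simp add: is_solution_def)
qed

section \<open>Restriction, gluing, translation and reversal of trajectories\<close>

lemma trajectory_subinterval:
  assumes "trajectory F a b \<phi>" "a \<le> c" "d \<le> b"
  shows "trajectory F c d \<phi>"
proof -
  have "t \<in> {a<..<b} - N" if "t \<in> {c<..<d} - N" for t N using that assms(2,3) by auto
  moreover have "abs_cont_on c d \<phi>"
    by (rule abs_cont_on_subinterval[of a b]) (use assms in \<open>simp_all add: trajectory_def\<close>)
  ultimately show ?thesis
    using assms(1) unfolding trajectory_def by meson
qed

lemma is_solution_Icc_iff: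
  assumes "0 \<le> T"
  shows "is_solution F x0 {0..T} \<phi> \<longleftrightarrow> \<phi> 0 = x0 \<and> trajectory F 0 T \<phi>"
proof -
  have "sol_domain {0..T}" using assms unfolding sol_domain_def by blast
  moreover have "(\<forall>S\<in>{0..T}. trajectory F 0 S \<phi>) \<longleftrightarrow> trajectory F 0 T \<phi>"
    using assms trajectory_subinterval[of F 0 T \<phi> 0] by auto
  ultimately show ?thesis unfolding is_solution_iff_trajectory by blast
qed

lemma trajectory_cong:
  assumes "trajectory F a b \<phi>" "\<And>t. t \<in> {a..b} \<Longrightarrow> \<psi> t = \<phi> t"
  shows "trajectory F a b \<psi>"
proof -
  have "(\<psi> has_vector_derivative v) (at t) \<and> v \<in> F (\<psi> t)"
    if "t \<in> {a<..<b}" "(\<phi> has_vector_derivative v) (at t)" "v \<in> F (\<phi> t)" for t v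
    using that assms(2) has_vector_derivative_transform_within_open[OF that(2), of "{a<..<b}" \<psi>] by auto
  then show ?thesis
    using assms abs_cont_on_cong[of a b \<phi> \<psi>] unfolding trajectory_def by (meson DiffD1)
qed

lemma trajectory_join:
  assumes "trajectory F a b \<phi>" "trajectory F b c \<phi>" "a \<le> b" "b \<le> c"
  shows "trajectory F a c \<phi>"
proof -
  let ?P = "\<lambda>t. \<exists>v. (\<phi> has_vector_derivative v) (at t) \<and> v \<in> F (\<phi> t)"
  obtain N M where N: "negligible N" "\<And>t. t \<in> {a<..<b} - N \<Longrightarrow> ?P t"
    and M: "negligible M" "\<And>t. t \<in> {b<..<c} - M \<Longrightarrow> ?P t"
    using assms by (auto simp: trajectory_def)
  have "?P t" if "t \<in> {a<..<c} - (N \<union> M \<union> {b})" for t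
    using that N(2)[of t] M(2)[of t] by (cases "t < b") auto
  moreover have "negligible (N \<union> M \<union> {b})" using N(1) M(1) by simp
  ultimately show ?thesis
    using assms abs_cont_on_join unfolding trajectory_def by blast
qed

lemma negligible_nonexpansive_image:
  fixes f :: "'a::euclidean_space \<Rightarrow> 'a"
  assumes "negligible N" "\<And>x y. norm (f x - f y) \<le> norm (x - y)"
  shows "negligible (f ` N)"
  using assms(2)
  by (intro negligible_locally_Lipschitz_image[OF _ assms(1)])
     (auto intro!: exI[of _ UNIV] exI[of _ "1::real"])

lemma trajectory_shift:
  assumes "trajectory F (a + c) (b + c) \<phi>"
  shows "trajectory F a b (\<lambda>t. \<phi> (t + c))"
proof -
  obtain N where N: "negligible N"
    "\<And>t. t \<in> {a + c<..<b + c} - N \<Longrightarrow> \<exists>v. (\<phi> has_vector_derivative v) (at t) \<and> v \<in> F (\<phi> t)"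
    using assms by (auto simp: trajectory_def)
  have "\<exists>v. ((\<lambda>t. \<phi> (t + c)) has_vector_derivative v) (at t) \<and> v \<in> F (\<phi> (t + c))"
    if t: "t \<in> {a<..<b} - (\<lambda>t. t + - c) ` N" for t
  proof -
    have "t + c \<in> {a + c<..<b + c} - N" using t by (auto simp: image_iff)
    then obtain v where v: "(\<phi> has_vector_derivative v) (at (t + c))" "v \<in> F (\<phi> (t + c))"
      using N(2) by blast
    have "((\<lambda>t. t + c) has_real_derivative 1) (at t)" by (auto intro!: derivative_eq_intros)
    from vector_diff_chain_at[OF this[unfolded has_real_derivative_iff_has_vector_derivative] v(1)]
    show ?thesis using v by (auto simp: o_def)
  qed
  moreover have "negligible ((\<lambda>t. t + - c) ` N)" by (rule negligible_nonexpansive_image[OF N(1)]) simp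
  ultimately show ?thesis
    using assms abs_cont_on_shift[of a c b \<phi>] unfolding trajectory_def by blast
qed

text \<open>The chain rule contributes the factor \<open>- 1\<close>, which turns velocities in
  \<open>F\<close> into velocities in its negative.\<close>

lemma trajectory_reflect:
  assumes "trajectory F a b \<phi>"
  shows "trajectory (\<lambda>x. uminus ` F x) (c - b) (c - a) (\<lambda>t. \<phi> (c - t))"
proof -
  obtain N where N: "negligible N"
    "\<And>t. t \<in> {a<..<b} - N \<Longrightarrow> \<exists>v. (\<phi> has_vector_derivative v) (at t) \<and> v \<in> F (\<phi> t)"
    using assms by (auto simp: trajectory_def)
  have "\<exists>v. ((\<lambda>t. \<phi> (c - t)) has_vector_derivative v) (at t) \<and> v \<in> uminus ` F (\<phi> (c - t))"
    if t: "t \<in> {c - b<..<c - a} - (\<lambda>t. c - t) ` N" for t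
  proof -
    have "c - t \<in> {a<..<b} - N" using t by (auto simp: image_iff)
    then obtain v where v: "(\<phi> has_vector_derivative v) (at (c - t))" "v \<in> F (\<phi> (c - t))"
      using N(2) by blast
    have "((\<lambda>t. c - t) has_real_derivative - 1) (at t)" by (auto intro!: derivative_eq_intros)
    from vector_diff_chain_at[OF this[unfolded has_real_derivative_iff_has_vector_derivative] v(1)]
    show ?thesis using v by (auto simp: o_def)
  qed
  moreover have "negligible ((\<lambda>t. c - t) ` N)"
    by (rule negligible_nonexpansive_image[OF N(1)]) simp
  ultimately show ?thesis
    using assms abs_cont_on_reflect[of a b \<phi> c] unfolding trajectory_def by blast
qed

lemma trajectory_difference_quotient:
  assumes "trajectory F a b \<phi>" "a < b" "closed C" "convex C"
    and "\<And>t. t \<in> {a<..<b} \<Longrightarrow> F (\<phi> t) \<subseteq> C"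
  shows "(\<phi> b - \<phi> a) /\<^sub>R (b - a) \<in> C"
proof -
  obtain N where N: "negligible N"
    "\<And>t. t \<in> {a<..<b} - N \<Longrightarrow> \<exists>v. (\<phi> has_vector_derivative v) (at t) \<and> v \<in> F (\<phi> t)"
    and ac: "abs_cont_on a b \<phi>"
    using assms(1) by (auto simp: trajectory_def)
  show ?thesis
  proof (rule abs_cont_difference_quotient_in_convex[OF assms(2) ac _ assms(3,4)])
    show "negligible (N \<union> {a, b})" using N(1) by simp
    fix t assume "t \<in> {a..b} - (N \<union> {a, b})"
    then have t: "t \<in> {a<..<b} - N" by auto
    then obtain v where v: "(\<phi> has_vector_derivative v) (at t)" "v \<in> F (\<phi> t)" using N(2) by blast
    then show "\<exists>v. (\<phi> has_vector_derivative v) (at t within {a..b}) \<and> v \<in> C"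
      using assms(5)[of t] t by (auto intro: has_vector_derivative_at_within)
  qed
qed

text \<open>Forward completeness speaks of maximal solutions only, so a maximal extension has to be
  produced, by Zorn's lemma. Its domain is unbounded and admissible, hence the whole
  half-line.\<close>

lemma solution_extends:
  assumes complete: "forward_complete F" and sol: "is_solution F x0 D \<phi>"
  obtains \<psi> where "is_solution F x0 {0..} \<psi>" "\<And>t. t \<in> D \<Longrightarrow> \<psi> t = \<phi> t"
proof -
  \<comment> \<open>Solutions are total functions with irrelevant values off their domain. Passing
    to graphs removes these values and makes extension the same as inclusion.\<close>
  define gr where "gr D \<phi> = (\<lambda>t. (t, \<phi> t)) ` D" for D :: "real set" and \<phi> :: "real \<Rightarrow> 'a"
  have gr_iff: "(t, y) \<in> gr D \<phi> \<longleftrightarrow> t \<in> D \<and> y = \<phi> t" for t y D \<phi> by (auto simp: gr_def)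
  define \<A> where "\<A> = {S. \<exists>E \<psi>. S = gr E \<psi> \<and> is_solution F x0 E \<psi> \<and> gr D \<phi> \<subseteq> S}"
  have "\<exists>M\<in>\<A>. \<forall>X\<in>\<A>. M \<subseteq> X \<longrightarrow> X = M"
  proof (rule subset_Zorn_nonempty)
    show "\<A> \<noteq> {}" using sol by (auto simp: \<A>_def)
  next
    fix \<C> assume ne: "\<C> \<noteq> {}" and chain: "subset.chain \<A> \<C>"
    then have CA: "\<C> \<subseteq> \<A>" and tot: "\<And>X Y. X \<in> \<C> \<Longrightarrow> Y \<in> \<C> \<Longrightarrow> X \<subseteq> Y \<or> Y \<subseteq> X"
      by (auto simp: subset_chain_def)
    have fn: "y = z" if tyz: "(t, y) \<in> \<Union>\<C>" "(t, z) \<in> \<Union>\<C>" for t y z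
    proof -
      obtain X Y where XY: "X \<in> \<C>" "Y \<in> \<C>" "(t, y) \<in> X" "(t, z) \<in> Y" using tyz by blast
      then obtain Z where "Z \<in> \<C>" "(t, y) \<in> Z" "(t, z) \<in> Z" using tot by blast
      then show ?thesis using CA by (auto simp: \<A>_def gr_iff)
    qed
    define E where "E = fst ` \<Union>\<C>"
    define \<psi> where "\<psi> t = (SOME y. (t, y) \<in> \<Union>\<C>)" for t
    have \<psi>: "\<psi> t = y" if "(t, y) \<in> \<Union>\<C>" for t y
      unfolding \<psi>_def using that fn by (intro some_equality) blast+
    have U: "\<Union>\<C> = gr E \<psi>" using \<psi> by (force simp: gr_def E_def image_iff)
    have part: "\<exists>E' \<psi>'. t \<in> E' \<and> is_solution F x0 E' \<psi>' \<and> E' \<subseteq> E \<and> (\<forall>s\<in>E'. \<psi> s = \<psi>' s)"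
      if tE: "t \<in> E" for t
    proof -
      obtain X y where X: "X \<in> \<C>" "(t, y) \<in> X" using tE by (auto simp: E_def)
      then obtain E' \<psi>' where E': "X = gr E' \<psi>'" "is_solution F x0 E' \<psi>'"
        using CA by (auto simp: \<A>_def)
      have mem: "(s, \<psi>' s) \<in> \<Union>\<C>" if "s \<in> E'" for s
        using X(1) E'(1) that by (auto simp: gr_def)
      have "E' \<subseteq> E" using imageI[OF mem, of _ fst] by (auto simp: E_def)
      moreover have "\<forall>s\<in>E'. \<psi> s = \<psi>' s" using \<psi>[OF mem] by blast
      moreover have "t \<in> E'" using X E' by (simp add: gr_iff)
      ultimately show ?thesis using E'(2) by blast
    qed
    have grU: "gr D \<phi> \<subseteq> \<Union>\<C>" using ne CA by (auto simp: \<A>_def)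
    have "is_solution F x0 E \<psi>"
      unfolding is_solution_iff_trajectory
    proof (intro conjI ballI)
      have "0 \<in> D" using sol by (simp add: is_solution_iff_trajectory sol_domain_iff)
      then have 0: "(0, \<phi> 0) \<in> \<Union>\<C>" using grU by (auto simp: gr_def)
      show "\<psi> 0 = x0"
        using \<psi>[OF 0] sol by (simp add: is_solution_iff_trajectory)
      have "t \<in> {0..} \<and> {0..t} \<subseteq> E" if "t \<in> E" for t
      proof -
        from part[OF that] obtain E' \<psi>' where E': "t \<in> E'" "is_solution F x0 E' \<psi>'" "E' \<subseteq> E" by blast
        then have "sol_domain E'" by (simp add: is_solution_def)
        from sol_domain_Icc_subset[OF this E'(1)] E'(3) show ?thesis by auto
      qed
      note E = this
      have "0 \<in> E" using imageI[OF 0, of fst] by (simp add: E_def)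
      moreover have "E \<subseteq> {0..}" using E by blast
      moreover have "x \<in> E" if "a \<in> E" "b \<in> E" "a \<le> x" "x \<le> b" for a b x
      proof -
        have "x \<in> {0..b}" using E[OF that(1)] that by auto
        then show ?thesis using E[OF that(2)] by blast
      qed
      ultimately show "sol_domain E"
        unfolding sol_domain_iff is_interval_1 by blast
      fix T assume T: "T \<in> E"
      from part[OF this] obtain E' \<psi>' where
        E': "T \<in> E'" "is_solution F x0 E' \<psi>'" "E' \<subseteq> E" "\<forall>s\<in>E'. \<psi> s = \<psi>' s" by blast
      then have "trajectory F 0 T \<psi>'" "sol_domain E'" by (auto simp: is_solution_iff_trajectory)
      then show "trajectory F 0 T \<psi>"
        using E'(4) sol_domain_Icc_subset(2)[OF _ E'(1)] by (blast intro: trajectory_cong)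
    qed
    then show "\<Union>\<C> \<in> \<A>" unfolding \<A>_def using U grU by blast
  qed
  then obtain M where M: "M \<in> \<A>" "\<And>X. X \<in> \<A> \<Longrightarrow> M \<subseteq> X \<Longrightarrow> X = M" by blast
  then obtain E \<psi> where E: "M = gr E \<psi>" "is_solution F x0 E \<psi>" "gr D \<phi> \<subseteq> M"
    by (auto simp: \<A>_def)
  have "is_maximal_solution F x0 E \<psi>"
    unfolding is_maximal_solution_def
  proof (intro conjI notI)
    assume "\<exists>E' \<psi>'. is_solution F x0 E' \<psi>' \<and> E \<subset> E' \<and> (\<forall>t\<in>E. \<psi>' t = \<psi> t)"
    then obtain E' \<psi>' where E': "is_solution F x0 E' \<psi>'" "E \<subset> E'" "\<forall>t\<in>E. \<psi>' t = \<psi> t" by blast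
    then have "M \<subseteq> gr E' \<psi>'" using E(1) by (auto simp: gr_def image_iff)
    moreover from this have "gr E' \<psi>' \<in> \<A>" unfolding \<A>_def using E'(1) E(3) by blast
    ultimately have "gr E' \<psi>' = gr E \<psi>" using M(2) E(1) by blast
    then have "fst ` gr E' \<psi>' = fst ` gr E \<psi>" by simp
    then show False using E'(2) by (auto simp: gr_def image_image)
  qed (rule E)
  then have "\<not> bounded E" using complete by (auto simp: forward_complete_def)
  moreover have "sol_domain E" using E(2) by (simp add: is_solution_iff_trajectory)
  ultimately have "E = {0..}"
    using bounded_subset[OF bounded_closed_interval, of "{0..<_}" 0]
    by (fastforce simp: sol_domain_def)
  moreover have "\<psi> t = \<phi> t" if "t \<in> D" for t
  proof -
    have "(t, \<phi> t) \<in> gr D \<phi>" using that by (simp add: gr_iff)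
    then have "(t, \<phi> t) \<in> gr E \<psi>" using E(1,3) by blast
    then show ?thesis by (simp add: gr_iff)
  qed
  ultimately show ?thesis using E(2) by (intro that[of \<psi>]) auto
qed

section \<open>Compactness of the solution set\<close>

text \<open>Near each point the values of \<open>G\<close> lie within distance one of a single
  bounded value; finitely many such neighbourhoods cover the closed ball.\<close>

lemma usc_compact_bounded_on_cball:
  fixes G :: "'a::euclidean_space \<Rightarrow> 'b::real_normed_vector set"
  assumes usc: "usc_setvalued G" and comp: "\<And>x. compact (G x)"
  shows "\<exists>M>0. \<forall>y. norm y \<le> R \<longrightarrow> G y \<subseteq> cball 0 M"
proof -
  have "\<exists>U. open U \<and> x \<in> U \<and> bounded (\<Union>y\<in>U. G y)" for x
  proof -
    obtain U where U: "open U" "x \<in> U" "\<And>y. y \<in> U \<Longrightarrow> G y \<subseteq> {a + b | a b. a \<in> G x \<and> norm b \<le> 1}"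
      using usc[unfolded usc_setvalued_def, rule_format, of 1 x] by auto
    obtain m where m: "\<And>a. a \<in> G x \<Longrightarrow> norm a \<le> m"
      using compact_imp_bounded[OF comp[of x]] unfolding bounded_iff by blast
    have "norm v \<le> m + 1" if v: "v \<in> (\<Union>y\<in>U. G y)" for v
    proof -
      obtain y where y: "y \<in> U" "v \<in> G y" using v by blast
      from subsetD[OF U(3)[OF y(1)] y(2)] obtain a b where "v = a + b" "a \<in> G x" "norm b \<le> 1"
        by blast
      then show ?thesis using m[of a] norm_triangle_ineq[of a b] by simp
    qed
    then have "bounded (\<Union>y\<in>U. G y)" unfolding bounded_iff by blast
    with U(1,2) show ?thesis by blast
  qed
  then obtain U where U: "\<And>x. open (U x)" "\<And>x. x \<in> U x" "\<And>x. bounded (\<Union>y\<in>U x. G y)"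
    by metis
  have "cball (0::'a) R \<subseteq> (\<Union>c\<in>UNIV. U c)" using U(2) by blast
  then obtain C where C: "finite C" "cball (0::'a) R \<subseteq> (\<Union>c\<in>C. U c)"
    using compactE_image[OF compact_cball _ , of UNIV U 0 R] U(1) by metis
  have "bounded (\<Union>c\<in>C. \<Union>y\<in>U c. G y)" using C(1) U(3) by (intro bounded_UN) auto
  then obtain M where "M > 0" and M: "\<And>v. v \<in> (\<Union>c\<in>C. \<Union>y\<in>U c. G y) \<Longrightarrow> norm v \<le> M"
    unfolding bounded_pos by blast
  have "G y \<subseteq> cball 0 M" if "norm y \<le> R" for y
  proof
    fix v assume "v \<in> G y"
    moreover have "y \<in> (\<Union>c\<in>C. U c)" using C(2) that by auto
    ultimately have "v \<in> (\<Union>c\<in>C. \<Union>y\<in>U c. G y)" by blast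
    from M[OF this] show "v \<in> cball 0 M" by simp
  qed
  with \<open>M > 0\<close> show ?thesis by blast
qed

lemma trajectory_lipschitz:
  assumes tr: "trajectory G a b \<phi>" and M: "\<And>t. t \<in> {a<..<b} \<Longrightarrow> G (\<phi> t) \<subseteq> cball 0 M"
    and cd: "a \<le> c" "c \<le> d" "d \<le> b"
  shows "norm (\<phi> d - \<phi> c) \<le> M * (d - c)"
proof (cases "c = d")
  case False
  then have "c < d" using cd by simp
  have "(\<phi> d - \<phi> c) /\<^sub>R (d - c) \<in> cball 0 M"
  proof (rule trajectory_difference_quotient[OF trajectory_subinterval[OF tr cd(1,3)] \<open>c < d\<close>])
    show "G (\<phi> t) \<subseteq> cball 0 M" if "t \<in> {c<..<d}" for t
      using M[of t] that cd by auto
  qed auto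
  then have "norm (\<phi> d - \<phi> c) / (d - c) \<le> M"
    using \<open>c < d\<close> by (simp add: divide_inverse_commute)
  then show ?thesis using \<open>c < d\<close> by (simp add: pos_divide_le_eq)
qed simp

text \<open>A first exit argument: until the norm reaches \<open>R + 1\<close> the speed is at most
  \<open>M\<close>, so the displacement stays below one and that level cannot be reached from norm
  at most \<open>R\<close>.\<close>

lemma trajectory_stays_bounded:
  assumes tr: "trajectory G a b \<phi>" and M: "\<And>y. norm y \<le> R + 1 \<Longrightarrow> G y \<subseteq> cball 0 M"
    and start: "norm (\<phi> a) \<le> R" and small: "M * (b - a) < 1" "0 < M" and t: "t \<in> {a..b}"
  shows "norm (\<phi> t) \<le> R + 1"
proof (rule ccontr)
  assume "\<not> norm (\<phi> t) \<le> R + 1"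
  define S where "S = {u \<in> {a..b}. R + 1 \<le> norm (\<phi> u)}"
  have cont: "continuous_on {a..b} \<phi>"
    using tr by (auto simp: trajectory_def intro: abs_cont_on_imp_continuous_on)
  have "closed S" unfolding S_def
    by (intro continuous_closed_preimage_constant continuous_on_closed_Collect_le continuous_intros cont)
  moreover have "t \<in> S" using \<open>\<not> norm (\<phi> t) \<le> R + 1\<close> t by (auto simp: S_def)
  moreover have bdd: "bdd_below S" by (auto simp: S_def intro!: bdd_belowI[of _ a])
  ultimately have u: "Inf S \<in> S" using closed_contains_Inf by blast
  define u where "u = Inf S"
  have uab: "a \<le> u" "u \<le> b" "R + 1 \<le> norm (\<phi> u)" using u by (auto simp: S_def u_def)
  have before: "norm (\<phi> s) \<le> R + 1" if "s \<in> {a<..<u}" for s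
  proof (rule ccontr)
    assume "\<not> norm (\<phi> s) \<le> R + 1"
    then have "s \<in> S" using that uab by (auto simp: S_def)
    then have "u \<le> s" unfolding u_def using bdd by (rule cInf_lower)
    with that show False by simp
  qed
  have "norm (\<phi> u - \<phi> a) \<le> M * (u - a)"
    using M before uab
    by (intro trajectory_lipschitz[OF trajectory_subinterval[OF tr order_refl uab(2)]]) auto
  also have "\<dots> \<le> M * (b - a)" using small uab by (intro mult_left_mono) auto
  finally have "norm (\<phi> u - \<phi> a) < 1" using small by simp
  then have "norm (\<phi> u) < R + 1" using start norm_triangle_sub[of "\<phi> u" "\<phi> a"] by simp
  with uab show False by simp
qed

lemma compact_thickening_closed_convex:
  fixes K :: "'a::euclidean_space set"
  assumes "compact K" "convex K"
  shows "closed {a + b | a b. a \<in> K \<and> norm b \<le> e}" "convex {a + b | a b. a \<in> K \<and> norm b \<le> e}"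
proof -
  have eq: "{a + b | a b. a \<in> K \<and> norm b \<le> e} = {a + b | a b. a \<in> K \<and> b \<in> cball 0 e}" by auto
  show "closed {a + b | a b. a \<in> K \<and> norm b \<le> e}"
    unfolding eq by (intro compact_imp_closed compact_sums assms compact_cball)
  have "{a + b | a b. a \<in> K \<and> b \<in> cball 0 e} = (\<Union>a\<in>K. \<Union>b\<in>cball 0 e. {a + b})" by blast
  then show "convex {a + b | a b. a \<in> K \<and> norm b \<le> e}"
    unfolding eq using convex_sums[OF assms(2) convex_cball[of 0 e]] by simp
qed

text \<open>Near time \<open>t\<close> all late approximations stay where \<open>G\<close> lies in
  the thickening of \<open>G (\<phi> t)\<close> by \<open>e\<close>. That set is closed and convex,
  so it contains their difference quotients over short intervals. The limits are taken in the order: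
  index of the sequence, step \<open>h\<close>, thickness \<open>e\<close>. Pointwise convergence is
  enough, and no convergence of derivatives enters.\<close>

lemma trajectory_limit:
  fixes G :: "'a::euclidean_space \<Rightarrow> 'a set"
  assumes usc: "usc_setvalued G" and comp: "\<And>x. compact (G x)" and conv: "\<And>x. convex (G x)"
    and tr: "\<And>k. trajectory G a b (\<Phi> k)"
    and bound: "\<And>k t. t \<in> {a..b} \<Longrightarrow> norm (\<Phi> k t) \<le> R"
    and lim: "\<And>t. t \<in> {a..b} \<Longrightarrow> (\<lambda>k. \<Phi> k t) \<longlonglongrightarrow> \<phi> t"
  shows "trajectory G a b \<phi>"
proof (cases "a \<le> b")
  case ab: True
  obtain M where "M > 0" and M: "\<And>y. norm y \<le> R \<Longrightarrow> G y \<subseteq> cball 0 M"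
    using usc_compact_bounded_on_cball[OF usc comp] by blast
  have lipk: "norm (\<Phi> k d - \<Phi> k c) \<le> M * (d - c)" if "a \<le> c" "c \<le> d" "d \<le> b" for k c d
    using that M bound by (intro trajectory_lipschitz[OF tr]) auto
  have lip: "norm (\<phi> d - \<phi> c) \<le> M * (d - c)" if "a \<le> c" "c \<le> d" "d \<le> b" for c d
  proof (rule LIMSEQ_le_const2)
    show "(\<lambda>k. norm (\<Phi> k d - \<Phi> k c)) \<longlonglongrightarrow> norm (\<phi> d - \<phi> c)"
      using that by (intro tendsto_intros lim) auto
  qed (use lipk that in blast)
  \<comment> \<open>Clamping extends the limit to a Lipschitz function on the whole line, the form
    in which almost everywhere differentiability is stated.\<close>
  define f where "f t = \<phi> (max a (min b t))" for t
  have flip: "norm (f x - f y) \<le> M * \<bar>x - y\<bar>" for x y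
  proof -
    have *: "norm (f x - f y) \<le> M * \<bar>x - y\<bar>" if "y \<le> x" for x y
    proof -
      have "norm (f x - f y) \<le> M * (max a (min b x) - max a (min b y))"
        unfolding f_def using that ab by (intro lip) auto
      also have "\<dots> \<le> M * \<bar>x - y\<bar>" using \<open>M > 0\<close> that by (intro mult_left_mono) auto
      finally show ?thesis .
    qed
    show ?thesis using *[of x y] *[of y x] by (cases "y \<le> x") (auto simp: norm_minus_commute)
  qed
  define N where "N = {t. \<not> f differentiable (at t)}"
  have "negligible N" unfolding N_def using flip by (rule lipschitz_differentiable_AE)
  moreover have "\<exists>v. (\<phi> has_vector_derivative v) (at t) \<and> v \<in> G (\<phi> t)"
    if t: "t \<in> {a<..<b} - N" for t
  proof -
    have "f differentiable (at t)" using t by (simp add: N_def)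
    then obtain v where "(f has_vector_derivative v) (at t)"
      using vector_derivative_works by blast
    then have v: "(\<phi> has_vector_derivative v) (at t)"
      by (rule has_vector_derivative_transform_within_open[where S = "{a<..<b}"])
         (use t in \<open>auto simp: f_def max_def min_def\<close>)
    have thick: "v \<in> {x + y | x y. x \<in> G (\<phi> t) \<and> norm y \<le> e}" (is "v \<in> ?C") if "e > 0" for e
    proof -
      note C = compact_thickening_closed_convex[OF comp conv, of "\<phi> t" e]
      obtain U where U: "open U" "\<phi> t \<in> U" "\<And>y. y \<in> U \<Longrightarrow> G y \<subseteq> ?C"
        using usc[unfolded usc_setvalued_def, rule_format, OF \<open>e > 0\<close>, of "\<phi> t"] by auto
      obtain \<rho> where \<rho>: "\<rho> > 0" "ball (\<phi> t) \<rho> \<subseteq> U" using U openE by blast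
      \<comment> \<open>Within time \<open>d\<close> an approximation moves by at most
        \<open>\<rho> / 2\<close>; the other half of \<open>\<rho>\<close> covers its distance from
        the limit at time \<open>t\<close>.\<close>
      define d where "d = min (b - t) (\<rho> / (2 * M))"
      have d: "d > 0" "d \<le> b - t" "M * d \<le> \<rho> / 2"
      proof -
        show "d > 0" "d \<le> b - t" using t \<rho> \<open>M > 0\<close> by (auto simp: d_def)
        have "M * d \<le> M * (\<rho> / (2 * M))"
          using \<open>M > 0\<close> by (intro mult_left_mono) (auto simp: d_def)
        then show "M * d \<le> \<rho> / 2" using \<open>M > 0\<close> by simp
      qed
      have DQ: "(\<phi> (t + h) - \<phi> t) /\<^sub>R h \<in> ?C" if h: "0 < h" "h < d" for h
      proof (rule Lim_in_closed_set[OF C(1)])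
        show "(\<lambda>k. (\<Phi> k (t + h) - \<Phi> k t) /\<^sub>R h) \<longlonglongrightarrow> (\<phi> (t + h) - \<phi> t) /\<^sub>R h"
          using h d t by (intro tendsto_intros lim) auto
        have "\<forall>\<^sub>F k in sequentially. dist (\<Phi> k t) (\<phi> t) < \<rho> / 2"
          using lim[of t] t \<rho> by (intro tendstoD) auto
        then show "\<forall>\<^sub>F k in sequentially. (\<Phi> k (t + h) - \<Phi> k t) /\<^sub>R h \<in> ?C"
        proof eventually_elim
          case (elim k)
          have tr': "trajectory G t (t + h) (\<Phi> k)"
            by (rule trajectory_subinterval[OF tr]) (use t h d in auto)
          have "(\<Phi> k (t + h) - \<Phi> k t) /\<^sub>R (t + h - t) \<in> ?C"
          proof (rule trajectory_difference_quotient[OF tr' _ C])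
            fix s assume s: "s \<in> {t<..<t + h}"
            have "norm (\<Phi> k s - \<Phi> k t) \<le> M * (s - t)" using s t h d by (intro lipk) auto
            also have "\<dots> \<le> M * d" using s h \<open>M > 0\<close> by (intro mult_left_mono) auto
            finally have "norm (\<Phi> k s - \<Phi> k t) \<le> \<rho> / 2" using d by simp
            then have "dist (\<Phi> k s) (\<phi> t) < \<rho>"
              using elim dist_triangle[of "\<Phi> k s" "\<phi> t" "\<Phi> k t"] by (simp add: dist_norm)
            then show "G (\<Phi> k s) \<subseteq> ?C" using \<rho> by (intro U(3)) (auto simp: dist_commute)
          qed (use h in simp)
          then show ?case by simp
        qed
      qed simp
      have "v \<in> closure ?C"
        unfolding closure_approachable
      proof (intro allI impI)
        fix \<eta> :: real assume "\<eta> > 0"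
        then have "\<eta> / 2 > 0" by simp
        from has_vector_derivative_straddle[OF v this] obtain d' where d': "d' > 0"
          "\<And>l r. \<lbrakk>l \<in> UNIV; r \<in> UNIV; l \<le> t; t \<le> r; {l..r} \<subseteq> ball t d'\<rbrakk> \<Longrightarrow>
            norm (\<phi> r - \<phi> l - (r - l) *\<^sub>R v) \<le> \<eta> / 2 * (r - l)" by blast
        define h where "h = min d d' / 2"
        have h: "0 < h" "h < d" "h < d'" using d d' by (auto simp: h_def)
        have "norm (\<phi> (t + h) - \<phi> t - (t + h - t) *\<^sub>R v) \<le> \<eta> / 2 * (t + h - t)"
          using h by (intro d'(2)) (auto simp: dist_real_def)
        then have le: "norm (\<phi> (t + h) - \<phi> t - h *\<^sub>R v) \<le> \<eta> / 2 * h" by simp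
        have "(\<phi> (t + h) - \<phi> t) /\<^sub>R h - v = (\<phi> (t + h) - \<phi> t - h *\<^sub>R v) /\<^sub>R h"
          using h by (simp add: scaleR_diff_right)
        also have "norm \<dots> = norm (\<phi> (t + h) - \<phi> t - h *\<^sub>R v) / h"
          using h by (simp add: divide_inverse_commute)
        also have "\<dots> \<le> \<eta> / 2" using le h by (simp add: pos_divide_le_eq)
        finally have "dist ((\<phi> (t + h) - \<phi> t) /\<^sub>R h) v < \<eta>" using \<open>\<eta> > 0\<close> by (simp add: dist_norm)
        with DQ[OF h(1,2)] show "\<exists>y\<in>?C. dist y v < \<eta>" by blast
      qed
      then show ?thesis using C(1) by simp
    qed
    have "v \<in> closure (G (\<phi> t))"
      unfolding closure_approachable
    proof (intro allI impI)
      fix e :: real assume "e > 0"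
      then have "e / 2 > 0" by simp
      from thick[OF this] obtain x y where "v = x + y" "x \<in> G (\<phi> t)" "norm y \<le> e / 2" by blast
      then show "\<exists>x\<in>G (\<phi> t). dist x v < e" using \<open>e > 0\<close> by (auto simp: dist_norm intro!: bexI[of _ x])
    qed
    then have "v \<in> G (\<phi> t)" using compact_imp_closed[OF comp] by simp
    with v show ?thesis by blast
  qed
  moreover have "abs_cont_on a b \<phi>" using lip by (rule abs_cont_on_lipschitz)
  ultimately show ?thesis unfolding trajectory_def by blast
next
  case False
  then show ?thesis
    by (auto simp: trajectory_def intro!: abs_cont_on_lipschitz[where K = 0] exI[of _ "{}"])
qed

lemma subseq_convergent_or_unbounded:
  fixes x :: "nat \<Rightarrow> 'a::euclidean_space"
  shows "\<exists>r. strict_mono r \<and> (convergent (x \<circ> r) \<or> (\<forall>R. \<forall>\<^sub>F k in sequentially. R < norm ((x \<circ> r) k)))"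
proof (cases "\<forall>R. \<forall>\<^sub>F k in sequentially. R < norm (x k)")
  case True
  then show ?thesis by (intro exI[of _ id]) (auto simp: strict_mono_def)
next
  case False
  then obtain R where "\<exists>\<^sub>F k in sequentially. norm (x k) \<le> R"
    by (auto simp: not_eventually not_less)
  then have "infinite {k. norm (x k) \<le> R}"
    by (simp add: frequently_cofinite[symmetric] cofinite_eq_sequentially)
  then obtain s :: "nat \<Rightarrow> nat" where s: "strict_mono s" "\<And>n. norm (x (s n)) \<le> R"
    using infinite_enumerate[of "{k. norm (x k) \<le> R}"] by auto
  have "bounded (range (x \<circ> s))" using s(2) by (auto intro!: boundedI[of _ R])
  then obtain l r where r: "strict_mono r" "((x \<circ> s) \<circ> r) \<longlonglongrightarrow> l"
    using bounded_imp_convergent_subsequence by blast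
  then have "strict_mono (s \<circ> r)" "convergent (x \<circ> (s \<circ> r))"
    using s(1) by (auto intro: strict_mono_o simp: convergent_def o_assoc)
  then show ?thesis by blast
qed

lemma diagonal_subseq_convergent_or_unbounded:
  fixes X :: "nat \<Rightarrow> real \<Rightarrow> 'a::euclidean_space"
  obtains r :: "nat \<Rightarrow> nat" where "strict_mono r"
    "\<And>q. q \<in> \<rat> \<Longrightarrow> convergent (\<lambda>k. X (r k) q) \<or> (\<forall>R. \<forall>\<^sub>F k in sequentially. R < norm (X (r k) q))"
proof -
  define e where "e = from_nat_into (\<rat> :: real set)"
  define P where "P n s \<longleftrightarrow> convergent (\<lambda>k. X (s k) (e n)) \<or>
      (\<forall>R. \<forall>\<^sub>F k in sequentially. R < norm (X (s k) (e n)))" for n and s :: "nat \<Rightarrow> nat"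
  interpret subseqs P
  proof
    fix n and s :: "nat \<Rightarrow> nat" assume "strict_mono s"
    show "\<exists>r'. strict_mono r' \<and> P n (s \<circ> r')"
      using subseq_convergent_or_unbounded[of "\<lambda>k. X (s k) (e n)"] by (simp add: P_def o_def)
  qed
  \<comment> \<open>Only the tail of the diagonal sequence is a subsequence of the one chosen for
    \<open>n\<close>. Both alternatives ignore finitely many terms, so the shift is removed
    afterwards.\<close>
  have "P n (diagseq \<circ> ((+) (Suc n)))" for n
  proof (rule diagseq_holds)
    fix r s :: "nat \<Rightarrow> nat" and n assume r: "strict_mono r" and P: "P n s"
    have "convergent (\<lambda>k. X (s (r k)) (e n))" if "convergent (\<lambda>k. X (s k) (e n))"
      using convergent_subseq_convergent[OF that r] by (simp add: o_def)
    moreover have "\<forall>\<^sub>F k in sequentially. R < norm (X (s (r k)) (e n))"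
      if "\<forall>\<^sub>F k in sequentially. R < norm (X (s k) (e n))" for R
      using eventually_subseq[OF r that] .
    ultimately show "P n (s \<circ> r)" using P by (auto simp: P_def)
  qed
  then have shifted: "convergent (\<lambda>k. X (diagseq (k + Suc n)) (e n)) \<or>
      (\<forall>R. \<forall>\<^sub>F k in sequentially. R < norm (X (diagseq (k + Suc n)) (e n)))" for n
    unfolding P_def o_def by (simp only: add.commute)
  have *: "convergent (\<lambda>k. X (diagseq k) (e n)) \<or>
      (\<forall>R. \<forall>\<^sub>F k in sequentially. R < norm (X (diagseq k) (e n)))" for n
    using shifted[of n] convergent_ignore_initial_segment[of "\<lambda>k. X (diagseq k) (e n)" "Suc n"]
      eventually_sequentially_seg[of "\<lambda>k. _ < norm (X (diagseq k) (e n))" "Suc n"] by metis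
  show ?thesis
  proof (rule that[OF subseq_diagseq])
    fix q :: real assume "q \<in> \<rat>"
    moreover have "range e = (\<rat> :: real set)"
      unfolding e_def by (rule range_from_nat_into) (auto simp: countable_rat)
    ultimately obtain n where "q = e n" by blast
    then show "convergent (\<lambda>k. X (diagseq k) q) \<or> (\<forall>R. \<forall>\<^sub>F k in sequentially. R < norm (X (diagseq k) q))"
      using *[of n] by simp
  qed
qed

text \<open>A continuation argument. Where the solutions are eventually bounded uniformly they
  converge, and the bound extends a little further. If the bounded horizons ended at a finite
  \<open>\<tau>\<close>, the limit would be a solution on \<open>{0..<\<tau>}\<close>; completeness
  extends it, so it is bounded up to \<open>\<tau>\<close>, and a step whose length depends on that
  bound alone, taken just before \<open>\<tau>\<close>, passes beyond it.\<close>

lemma solutions_compact: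
  fixes G :: "'a::euclidean_space \<Rightarrow> 'a set"
  assumes usc: "usc_setvalued G" and comp: "\<And>x. compact (G x)" and conv: "\<And>x. convex (G x)"
    and complete: "forward_complete G"
    and sol: "\<And>k. is_solution G (x k) {0..} (\<Phi> k)" and x: "x \<longlonglongrightarrow> x0"
    and s: "s \<longlonglongrightarrow> S" "\<And>k. 0 \<le> s k"
  obtains r \<phi> where "strict_mono r" "is_solution G x0 {0..} \<phi>"
    "(\<lambda>k. \<Phi> (r k) (s (r k))) \<longlonglongrightarrow> \<phi> S"
proof -
  obtain r where r: "strict_mono r"
    and rat: "\<And>q. q \<in> \<rat> \<Longrightarrow> convergent (\<lambda>k. \<Phi> (r k) q) \<or>
      (\<forall>R. \<forall>\<^sub>F k in sequentially. R < norm (\<Phi> (r k) q))"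
    using diagonal_subseq_convergent_or_unbounded by blast
  define \<Psi> where "\<Psi> k = \<Phi> (r k)" for k
  have tr: "trajectory G 0 T (\<Psi> k)" if "0 \<le> T" for k T
    using sol[of "r k"] that by (simp add: \<Psi>_def is_solution_iff_trajectory)
  have tr': "trajectory G a b (\<Psi> k)" if "0 \<le> a" "a \<le> b" for k a b
    by (rule trajectory_subinterval[OF tr[of b]]) (use that in auto)
  have "\<forall>R. \<exists>M>0. \<forall>y. norm y \<le> R \<longrightarrow> G y \<subseteq> cball 0 M"
    using usc_compact_bounded_on_cball[OF usc comp] by blast
  then obtain M where M0: "\<And>R. M R > 0" and M: "\<And>R y. norm y \<le> R \<Longrightarrow> G y \<subseteq> cball 0 (M R)"
    by metis
  have lip: "norm (\<Psi> k d - \<Psi> k c) \<le> M R * (d - c)"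
    if "\<forall>u\<in>{0..T}. norm (\<Psi> k u) \<le> R" "0 \<le> c" "c \<le> d" "d \<le> T" for k c d T R
    using that M by (intro trajectory_lipschitz[OF tr[of T]]) auto
  define bdd where "bdd T \<longleftrightarrow> (\<exists>R. \<forall>\<^sub>F k in sequentially. \<forall>u\<in>{0..T}. norm (\<Psi> k u) \<le> R)" for T
  have \<Psi>0: "(\<lambda>k. \<Psi> k 0) \<longlonglongrightarrow> x0"
    using LIMSEQ_subseq_LIMSEQ[OF x r] sol by (simp add: \<Psi>_def o_def is_solution_def)
  have bdd_mono: "bdd T" if "bdd T'" "T \<le> T'" for T T'
    using that unfolding bdd_def by (fastforce elim!: eventually_mono)
  \<comment> \<open>At speed at most \<open>M (R + 1)\<close> the time \<open>\<delta> R\<close>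
    allows a displacement of \<open>1 / 2\<close>, less than the unit gap between the levels
    \<open>R\<close> and \<open>R + 1\<close>.\<close>
  define \<delta> where "\<delta> R = 1 / (2 * M (R + 1))" for R
  have \<delta>0: "\<delta> R > 0" for R using M0 by (simp add: \<delta>_def)
  have step: "bdd (T + \<delta> R)"
    if "0 \<le> T" "bdd T" and ev: "\<forall>\<^sub>F k in sequentially. norm (\<Psi> k T) \<le> R" for T R
  proof -
    obtain R' where "\<forall>\<^sub>F k in sequentially. \<forall>u\<in>{0..T}. norm (\<Psi> k u) \<le> R'"
      using \<open>bdd T\<close> by (auto simp: bdd_def)
    with ev have "\<forall>\<^sub>F k in sequentially. \<forall>u\<in>{0..T + \<delta> R}. norm (\<Psi> k u) \<le> max R' (R + 1)"
    proof eventually_elim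
      case (elim k)
      have "norm (\<Psi> k u) \<le> R + 1" if "u \<in> {T..T + \<delta> R}" for u
      proof (rule trajectory_stays_bounded[where G = G and M = "M (R + 1)", OF tr' M _ _ _ that])
        show "M (R + 1) * (T + \<delta> R - T) < 1" using M0[of "R + 1"] by (simp add: \<delta>_def)
      qed (use elim \<open>0 \<le> T\<close> \<delta>0[of R] M0 in auto)
      then show ?case using elim by (auto simp: le_max_iff_disj)
    qed
    then show ?thesis unfolding bdd_def by blast
  qed
  have step': "\<exists>d>0. bdd (T + d)" if "0 \<le> T" "bdd T" for T
  proof -
    obtain R where "\<forall>\<^sub>F k in sequentially. \<forall>u\<in>{0..T}. norm (\<Psi> k u) \<le> R"
      using \<open>bdd T\<close> by (auto simp: bdd_def)
    then have "\<forall>\<^sub>F k in sequentially. norm (\<Psi> k T) \<le> R"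
      by eventually_elim (use \<open>0 \<le> T\<close> in auto)
    then show ?thesis using step[OF that] \<delta>0 by blast
  qed
  have bdd0: "bdd 0"
  proof -
    have "\<forall>\<^sub>F k in sequentially. dist (\<Psi> k 0) x0 < 1" using \<Psi>0 by (rule tendstoD) simp
    then have "\<forall>\<^sub>F k in sequentially. \<forall>u\<in>{0..0}. norm (\<Psi> k u) \<le> norm x0 + 1"
    proof eventually_elim
      case (elim k)
      then show ?case using norm_triangle_sub[of "\<Psi> k 0" x0] by (simp add: dist_norm)
    qed
    then show ?thesis unfolding bdd_def by blast
  qed
  define \<phi> where "\<phi> t = lim (\<lambda>k. \<Psi> k t)" for t
  have lim: "(\<lambda>k. \<Psi> k t) \<longlonglongrightarrow> \<phi> t" if t: "0 \<le> t" "bdd t" for t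
  proof -
    obtain d where d: "d > 0" "bdd (t + d)" using step'[OF t] by blast
    then obtain R where R: "\<forall>\<^sub>F k in sequentially. \<forall>u\<in>{0..t + d}. norm (\<Psi> k u) \<le> R"
      by (auto simp: bdd_def)
    have "Cauchy (\<lambda>k. \<Psi> k t)"
    proof (rule metric_CauchyI)
      fix e :: real assume "e > 0"
      \<comment> \<open>The rational \<open>q\<close> lies in \<open>{0..t + d}\<close>, where the
        bound \<open>R\<close> excludes divergence to infinity, and so close to \<open>t\<close>
        that passing from \<open>q\<close> to \<open>t\<close> costs at most \<open>e / 4\<close>
        for each of two solutions; \<open>e / 2\<close> remains for convergence at
        \<open>q\<close>.\<close>
      have "t < t + min d (e / (4 * M R))" using d \<open>e > 0\<close> M0[of R] by simp
      then obtain q where q: "q \<in> \<rat>" "t < q" "q < t + min d (e / (4 * M R))"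
        using Rats_dense_in_real by blast
      have qd: "q \<in> {0..t + d}" using q t by auto
      have "M R * (q - t) \<le> M R * (e / (4 * M R))"
        using q M0[of R] by (intro mult_left_mono) auto
      then have Mq: "M R * (q - t) \<le> e / 4" using M0[of R] by simp
      have "\<not> (\<forall>\<^sub>F k in sequentially. R < norm (\<Psi> k q))"
      proof
        assume "\<forall>\<^sub>F k in sequentially. R < norm (\<Psi> k q)"
        with R have "\<forall>\<^sub>F k in sequentially. False"
          by eventually_elim (use qd in force)
        then show False by simp
      qed
      then have "convergent (\<lambda>k. \<Psi> k q)" using rat[OF q(1)] by (auto simp: \<Psi>_def)
      then have "Cauchy (\<lambda>k. \<Psi> k q)" by (simp add: Cauchy_convergent_iff)
      then obtain K1 where K1: "\<And>m n. m \<ge> K1 \<Longrightarrow> n \<ge> K1 \<Longrightarrow> dist (\<Psi> m q) (\<Psi> n q) < e / 2"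
        using metric_CauchyD[of _ "e / 2"] \<open>e > 0\<close> by (metis half_gt_zero)
      obtain K2 where K2: "\<And>k. k \<ge> K2 \<Longrightarrow> \<forall>u\<in>{0..t + d}. norm (\<Psi> k u) \<le> R"
        using R by (auto simp: eventually_sequentially)
      have near: "dist (\<Psi> k q) (\<Psi> k t) \<le> e / 4" if "k \<ge> K2" for k
        using lip[OF K2[OF that], of t q] Mq q qd t(1) by (simp add: dist_norm)
      have "dist (\<Psi> m t) (\<Psi> n t) < e" if "m \<ge> max K1 K2" "n \<ge> max K1 K2" for m n
      proof -
        have "dist (\<Psi> m t) (\<Psi> n t) \<le> dist (\<Psi> m q) (\<Psi> m t) + dist (\<Psi> m q) (\<Psi> n q) + dist (\<Psi> n q) (\<Psi> n t)"
          by metric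
        then show ?thesis using near[of m] near[of n] K1[of m n] that by simp
      qed
      then show "\<exists>K. \<forall>m\<ge>K. \<forall>n\<ge>K. dist (\<Psi> m t) (\<Psi> n t) < e" by blast
    qed
    then show ?thesis unfolding \<phi>_def by (simp add: Cauchy_convergent_iff convergent_LIMSEQ_iff)
  qed
  have trlim: "trajectory G 0 T \<phi>" if "0 \<le> T" "bdd T" for T
  proof -
    obtain R K where K: "\<And>k. k \<ge> K \<Longrightarrow> \<forall>u\<in>{0..T}. norm (\<Psi> k u) \<le> R"
      using \<open>bdd T\<close> by (auto simp: bdd_def eventually_sequentially)
    show ?thesis
    proof (rule trajectory_limit[where \<Phi> = "\<lambda>k. \<Psi> (k + K)", OF usc comp conv tr[OF that(1)]])
      show "norm (\<Psi> (k + K) t) \<le> R" if "t \<in> {0..T}" for k t using K[of "k + K"] that by simp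
      show "(\<lambda>k. \<Psi> (k + K) t) \<longlonglongrightarrow> \<phi> t" if "t \<in> {0..T}" for t
        using lim[of t] bdd_mono[OF \<open>bdd T\<close>, of t] that by (intro LIMSEQ_ignore_initial_segment) auto
    qed
  qed
  have \<phi>0: "\<phi> 0 = x0" using LIMSEQ_unique[OF lim[OF order_refl bdd0] \<Psi>0] .
  have all: "bdd T" if "0 \<le> T" for T
  proof (rule ccontr)
    assume nT: "\<not> bdd T"
    define J where "J = {t. 0 \<le> t \<and> bdd t}"
    have "0 \<in> J" using bdd0 by (simp add: J_def)
    have "bdd_above J"
      unfolding J_def using bdd_mono nT by (intro bdd_aboveI[of _ T]) (metis (lifting) linear mem_Collect_eq)
    define \<tau> where "\<tau> = Sup J"
    have up: "t \<le> \<tau>" if "t \<in> J" for t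
      unfolding \<tau>_def using that \<open>bdd_above J\<close> by (rule cSup_upper)
    have less: "t < \<tau>" if tJ: "t \<in> J" for t
    proof -
      obtain d where "d > 0" "bdd (t + d)" using step' tJ by (auto simp: J_def)
      then have "t + d \<in> J" using tJ by (simp add: J_def)
      from up[OF this] \<open>d > 0\<close> show ?thesis by simp
    qed
    have mem: "t \<in> J" if t: "0 \<le> t" "t < \<tau>" for t
    proof -
      obtain t' where "t' \<in> J" "t < t'" using t \<open>0 \<in> J\<close> less_cSupD[of J t] by (auto simp: \<tau>_def)
      then show ?thesis using bdd_mono[of t' t] t by (auto simp: J_def)
    qed
    have J: "J = {0..<\<tau>}" using less mem by (auto simp: J_def)
    have "\<tau> > 0" using less \<open>0 \<in> J\<close> by blast
    have "is_solution G x0 J \<phi>"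
      unfolding is_solution_iff_trajectory
      using J \<open>\<tau> > 0\<close> \<phi>0 trlim by (auto simp: sol_domain_def J_def)
    \<comment> \<open>Here completeness excludes escape in finite time: the extension is continuous
      on the compact interval \<open>{0..\<tau>}\<close>.\<close>
    from solution_extends[OF complete this] obtain \<psi> where
      \<psi>: "is_solution G x0 {0..} \<psi>" "\<And>t. t \<in> J \<Longrightarrow> \<psi> t = \<phi> t" by blast
    have "continuous_on {0..\<tau>} \<psi>"
      using \<psi>(1) \<open>\<tau> > 0\<close>
      by (auto simp: is_solution_iff_trajectory trajectory_def intro: abs_cont_on_imp_continuous_on)
    then have "bounded (\<psi> ` {0..\<tau>})"
      by (intro compact_imp_bounded compact_continuous_image) auto
    then obtain R where R: "\<And>t. t \<in> {0..\<tau>} \<Longrightarrow> norm (\<psi> t) \<le> R"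
      by (meson bounded_iff imageI)
    \<comment> \<open>Late solutions are within one of the limit at \<open>t\<close>, hence of norm
      at most \<open>R + 1\<close>. Starting half a step before \<open>\<tau>\<close>, or at 0, a
      step of length \<open>\<delta> (R + 1)\<close> reaches past \<open>\<tau>\<close>.\<close>
    define t where "t = max 0 (\<tau> - \<delta> (R + 1) / 2)"
    have t: "0 \<le> t" "t < \<tau>" "\<tau> < t + \<delta> (R + 1)"
      using \<open>\<tau> > 0\<close> \<delta>0[of "R + 1"] by (auto simp: t_def)
    have tJ: "t \<in> J" using mem t by blast
    have "(\<lambda>k. \<Psi> k t) \<longlonglongrightarrow> \<phi> t" using lim tJ by (simp add: J_def)
    then have ev: "\<forall>\<^sub>F k in sequentially. dist (\<Psi> k t) (\<phi> t) < 1" by (rule tendstoD) simp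
    have nphi: "norm (\<phi> t) \<le> R" using R[of t] \<psi>(2)[OF tJ] t by simp
    from ev have "\<forall>\<^sub>F k in sequentially. norm (\<Psi> k t) \<le> R + 1"
    proof eventually_elim
      case (elim k)
      then show ?case using nphi norm_triangle_sub[of "\<Psi> k t" "\<phi> t"] by (simp add: dist_norm)
    qed
    then have "bdd (t + \<delta> (R + 1))" using step tJ by (simp add: J_def)
    then have "t + \<delta> (R + 1) \<in> J" using t by (simp add: J_def)
    from less[OF this] t show False by simp
  qed
  have "is_solution G x0 {0..} \<phi>"
    unfolding is_solution_iff_trajectory using \<phi>0 trlim all by (auto simp: sol_domain_def)
  moreover have "(\<lambda>k. \<Phi> (r k) (s (r k))) \<longlonglongrightarrow> \<phi> S"
  proof -
    have S0: "0 \<le> S" using s by (intro LIMSEQ_le_const[OF s(1)]) auto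
    obtain R where R: "\<forall>\<^sub>F k in sequentially. \<forall>u\<in>{0..S + 1}. norm (\<Psi> k u) \<le> R"
      using all[of "S + 1"] S0 by (auto simp: bdd_def)
    have sr: "(\<lambda>k. s (r k)) \<longlonglongrightarrow> S" using LIMSEQ_subseq_LIMSEQ[OF s(1) r] by (simp add: o_def)
    then have "\<forall>\<^sub>F k in sequentially. s (r k) < S + 1" by (rule order_tendstoD) simp
    \<comment> \<open>The evaluation times move with the index; a Lipschitz constant common to late
      solutions reduces them to the fixed time \<open>S\<close>.\<close>
    with R have "\<forall>\<^sub>F k in sequentially. norm (\<Psi> k (s (r k)) - \<Psi> k S) \<le> M R * \<bar>s (r k) - S\<bar>"
    proof eventually_elim
      case (elim k)
      show ?case
        using lip[OF elim(1), of S "s (r k)"] lip[OF elim(1), of "s (r k)" S] elim(2) s(2) S0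
        by (cases "S \<le> s (r k)") (auto simp: norm_minus_commute)
    qed
    moreover have "(\<lambda>k. M R * \<bar>s (r k) - S\<bar>) \<longlonglongrightarrow> M R * \<bar>S - S\<bar>"
      by (intro tendsto_intros sr)
    then have "(\<lambda>k. M R * \<bar>s (r k) - S\<bar>) \<longlonglongrightarrow> 0" by simp
    ultimately have "(\<lambda>k. \<Psi> k (s (r k)) - \<Psi> k S) \<longlonglongrightarrow> 0"
      by (rule Lim_null_comparison)
    from tendsto_add[OF this lim[OF S0 all[OF S0]]] show ?thesis by (simp add: \<Psi>_def)
  qed
  ultimately show ?thesis using that r by blast
qed

section \<open>Reachability and the barrier function\<close>

definition reach :: "('a::euclidean_space \<Rightarrow> 'a set) \<Rightarrow> real \<Rightarrow> 'a \<Rightarrow> 'a \<Rightarrow> bool" where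
  "reach F s y x \<longleftrightarrow> 0 \<le> s \<and> (\<exists>\<phi>. trajectory F 0 s \<phi> \<and> \<phi> 0 = y \<and> \<phi> s = x)"

lemma reach_refl: "reach F 0 x x"
  unfolding reach_def trajectory_def
  by (intro conjI exI[of _ "\<lambda>_. x"] exI[of _ "{}"]) (simp_all add: abs_cont_on_const)

lemma trajectory_imp_reach:
  assumes "trajectory F a b \<phi>" "a \<le> b"
  shows "reach F (b - a) (\<phi> a) (\<phi> b)"
proof -
  have "trajectory F 0 (b - a) (\<lambda>t. \<phi> (t + a))"
    by (rule trajectory_shift) (use assms in simp)
  then show ?thesis
    unfolding reach_def using assms(2) by (intro conjI exI[of _ "\<lambda>t. \<phi> (t + a)"]) auto
qed

lemma reach_trans:
  assumes "reach F s y x" "reach F s' x z"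
  shows "reach F (s + s') y z"
proof -
  obtain \<phi> \<psi> where \<phi>: "trajectory F 0 s \<phi>" "\<phi> 0 = y" "\<phi> s = x" "0 \<le> s"
    and \<psi>: "trajectory F 0 s' \<psi>" "\<psi> 0 = x" "\<psi> s' = z" "0 \<le> s'"
    using assms by (auto simp: reach_def)
  define \<omega> where "\<omega> t = (if t \<le> s then \<phi> t else \<psi> (t + - s))" for t
  have "trajectory F 0 s \<omega>" using \<phi>(1) by (rule trajectory_cong) (simp add: \<omega>_def)
  moreover have "trajectory F s (s + s') (\<lambda>t. \<psi> (t + - s))"
    by (rule trajectory_shift) (use \<psi>(1) in simp)
  then have "trajectory F s (s + s') \<omega>"
    by (rule trajectory_cong) (use \<phi>(3) \<psi>(2) in \<open>auto simp: \<omega>_def\<close>)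
  ultimately have "trajectory F 0 (s + s') \<omega>"
    by (rule trajectory_join) (use \<phi>(4) \<psi>(4) in simp_all)
  moreover have "\<omega> 0 = y" "\<omega> (s + s') = z" using \<phi> \<psi> by (auto simp: \<omega>_def)
  ultimately show ?thesis using \<phi>(4) \<psi>(4) unfolding reach_def by (intro conjI exI[of _ \<omega>]) auto
qed

text \<open>Reversing twice restores \<open>F\<close>, so one implication gives both.\<close>

lemma reach_uminus: "reach (\<lambda>x. uminus ` F x) s x y \<longleftrightarrow> reach F s y x"
proof -
  have *: "reach (\<lambda>x. uminus ` F x) s x y" if "reach F s y x" for F :: "'a \<Rightarrow> 'a set" and x y
  proof -
    obtain \<phi> where \<phi>: "trajectory F 0 s \<phi>" "\<phi> 0 = y" "\<phi> s = x" "0 \<le> s"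
      using \<open>reach F s y x\<close> by (auto simp: reach_def)
    from trajectory_reflect[OF \<phi>(1), of s] \<phi> show ?thesis
      unfolding reach_def by (intro conjI exI[of _ "\<lambda>t. \<phi> (s - t)"]) auto
  qed
  show ?thesis using *[of F y x] *[of "\<lambda>x. uminus ` F x" x y] by (auto simp: image_image)
qed

lemma usc_setvalued_uminus:
  assumes "usc_setvalued F"
  shows "usc_setvalued (\<lambda>x. uminus ` F x)"
  unfolding usc_setvalued_def
proof (intro allI impI)
  fix x and \<epsilon> :: real assume "\<epsilon> > 0"
  then obtain U where U: "open U" "x \<in> U" "\<forall>y\<in>U. F y \<subseteq> {a + b | a b. a \<in> F x \<and> norm b \<le> \<epsilon>}"
    using assms unfolding usc_setvalued_def by blast
  have "uminus ` F y \<subseteq> {a + b | a b. a \<in> uminus ` F x \<and> norm b \<le> \<epsilon>}" if y: "y \<in> U" for y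
  proof
    fix v assume "v \<in> uminus ` F y"
    then obtain w where w: "w \<in> F y" "v = - w" by blast
    then obtain a b where "w = a + b" "a \<in> F x" "norm b \<le> \<epsilon>" using U(3) y by blast
    then have "v = - a + - b" "- a \<in> uminus ` F x" "norm (- b) \<le> \<epsilon>" using w by auto
    then show "v \<in> {a + b | a b. a \<in> uminus ` F x \<and> norm b \<le> \<epsilon>}" by blast
  qed
  with U(1,2) show "\<exists>U. open U \<and> x \<in> U \<and>
      (\<forall>y\<in>U. uminus ` F y \<subseteq> {a + b | a b. a \<in> uminus ` F x \<and> norm b \<le> \<epsilon>})"
    by (intro exI[of _ U] conjI ballI)
qed

text \<open>Reversed in time, the arcs start at the convergent points \<open>x k\<close> and attain
  \<open>y k\<close> at time \<open>s k\<close>. Their lengths differ; extension to the half-line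
  gives them a common domain.\<close>

lemma reach_closed:
  fixes F :: "'a::euclidean_space \<Rightarrow> 'a set"
  assumes F: "usc_setvalued F" "\<And>x. compact (F x)" "\<And>x. convex (F x)" "backward_complete F"
    and reach: "\<And>k. reach F (s k) (y k) (x k)" and s: "s \<longlonglongrightarrow> S" and x: "x \<longlonglongrightarrow> x0"
  obtains r y0 where "strict_mono r" "(y \<circ> r) \<longlonglongrightarrow> y0" "reach F S y0 x0"
proof -
  define G where "G = (\<lambda>x. uminus ` F x)"
  have comp: "compact (G x)" and conv: "convex (G x)" for x
    using F(2,3) by (auto simp: G_def compact_negations convex_negations)
  have usc: "usc_setvalued G" unfolding G_def by (rule usc_setvalued_uminus[OF F(1)])
  have complete: "forward_complete G" using F(4) by (simp add: backward_complete_def G_def)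
  have s0: "0 \<le> s k" for k using reach[of k] by (simp add: reach_def)
  have "\<exists>\<Phi>. is_solution G (x k) {0..} \<Phi> \<and> \<Phi> (s k) = y k" for k
  proof -
    obtain \<phi> where \<phi>: "trajectory G 0 (s k) \<phi>" "\<phi> 0 = x k" "\<phi> (s k) = y k"
      using reach_uminus[of F "s k" "x k" "y k"] reach[of k] by (auto simp: G_def reach_def)
    then have "is_solution G (x k) {0..s k} \<phi>" using s0 by (simp add: is_solution_Icc_iff)
    from solution_extends[OF complete this] obtain \<Phi> where
      "is_solution G (x k) {0..} \<Phi>" "\<And>t. t \<in> {0..s k} \<Longrightarrow> \<Phi> t = \<phi> t" by blast
    then show ?thesis using \<phi>(3) s0 by auto
  qed
  then obtain \<Phi> where \<Phi>: "\<And>k. is_solution G (x k) {0..} (\<Phi> k)" "\<And>k. \<Phi> k (s k) = y k" by metis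
  obtain r \<phi> where r: "strict_mono r" "is_solution G x0 {0..} \<phi>"
      "(\<lambda>k. \<Phi> (r k) (s (r k))) \<longlonglongrightarrow> \<phi> S"
    using solutions_compact[OF usc comp conv complete \<Phi>(1) x s s0] by blast
  have S0: "0 \<le> S" using s0 by (intro LIMSEQ_le_const[OF s]) auto
  have "reach G S x0 (\<phi> S)"
    using r(2) S0 unfolding reach_def is_solution_iff_trajectory by (auto intro!: exI[of _ \<phi>])
  then have "reach F S (\<phi> S) x0" unfolding G_def reach_uminus .
  moreover have "(y \<circ> r) \<longlonglongrightarrow> \<phi> S" using r(3) by (simp add: \<Phi>(2) o_def)
  ultimately show ?thesis using that r(1) by blast
qed

text \<open>For \<open>t \<ge> 0\<close> the set contains the distance of \<open>x\<close> itself,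
  through \<open>s = 0\<close>. For negative \<open>t\<close> it is empty and the infimum has no
  meaning.\<close>

definition reach_barrier :: "('a::euclidean_space \<Rightarrow> 'a set) \<Rightarrow> 'a set \<Rightarrow> real \<times> 'a \<Rightarrow> real" where
  "reach_barrier F Xo = (\<lambda>(t, x). Inf {infdist y Xo | s y. s \<le> t \<and> reach F s y x})"

lemma reach_barrier_le:
  assumes "reach F s y x" "s \<le> t"
  shows "reach_barrier F Xo (t, x) \<le> infdist y Xo"
  unfolding reach_barrier_def using assms
  by (auto intro!: cInf_lower bdd_belowI[of _ 0] infdist_nonneg)

lemma reach_barrier_lessD:
  assumes "reach_barrier F Xo (t, x) < c" "0 \<le> t"
  obtains s y where "s \<le> t" "reach F s y x" "infdist y Xo < c"
proof -
  have "{infdist y Xo | s y. s \<le> t \<and> reach F s y x} \<noteq> {}" using assms(2) reach_refl by blast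
  from cInf_lessD[OF this] assms(1) show ?thesis using that by (auto simp: reach_barrier_def)
qed

lemma reach_barrier_antimono:
  assumes "reach F s x x'" "0 \<le> t"
  shows "reach_barrier F Xo (t + s, x') \<le> reach_barrier F Xo (t, x)"
proof (rule ccontr)
  assume "\<not> ?thesis"
  then have "reach_barrier F Xo (t, x) < reach_barrier F Xo (t + s, x')" by simp
  then obtain u y where u: "u \<le> t" "reach F u y x" "infdist y Xo < reach_barrier F Xo (t + s, x')"
    using assms(2) by (rule reach_barrier_lessD)
  have "reach_barrier F Xo (t + s, x') \<le> infdist y Xo"
    using reach_trans[OF u(2) assms(1)] u(1) by (intro reach_barrier_le) auto
  with u(3) show False by simp
qed

text \<open>The compactness statement behind both lower semicontinuity and the attainment of level
  zero. The durations are bounded because the times \<open>t k\<close> converge, so a first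
  extraction makes them converge and a second one the starting points.\<close>

lemma reach_barrier_limit:
  fixes F :: "'a::euclidean_space \<Rightarrow> 'a set"
  assumes F: "usc_setvalued F" "\<And>x. compact (F x)" "\<And>x. convex (F x)" "backward_complete F"
    and lim: "t \<longlonglongrightarrow> t0" "x \<longlonglongrightarrow> x0" "c \<longlonglongrightarrow> c0"
    and less: "\<And>k. 0 \<le> t k" "\<And>k. reach_barrier F Xo (t k, x k) < c k"
  obtains s y where "s \<le> t0" "reach F s y x0" "infdist y Xo \<le> c0"
proof -
  have "\<exists>s y. s \<le> t k \<and> reach F s y (x k) \<and> infdist y Xo < c k" for k
    using reach_barrier_lessD[OF less(2,1)] by metis
  then obtain s y where sy: "\<And>k. s k \<le> t k" "\<And>k. reach F (s k) (y k) (x k)"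
      "\<And>k. infdist (y k) Xo < c k" by metis
  have s0: "0 \<le> s k" for k using sy(2)[of k] by (simp add: reach_def)
  have "Bseq t" using lim(1) by (intro convergent_imp_Bseq convergentI)
  then obtain B where "\<And>k. norm (t k) \<le> B" by (auto simp: Bseq_def)
  then have "norm (s k) \<le> B" for k using sy(1)[of k] s0[of k] by (metis abs_of_nonneg order_trans real_norm_def)
  then have "bounded (range s)" by (auto intro!: boundedI)
  then obtain S r1 where r1: "strict_mono r1" "(s \<circ> r1) \<longlonglongrightarrow> S"
    using bounded_imp_convergent_subsequence by blast
  have "reach F ((s \<circ> r1) k) ((y \<circ> r1) k) ((x \<circ> r1) k)" for k using sy(2) by simp
  from reach_closed[OF F this r1(2) LIMSEQ_subseq_LIMSEQ[OF lim(2) r1(1)]]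
  obtain r2 y0 where r2: "strict_mono r2" "(y \<circ> r1 \<circ> r2) \<longlonglongrightarrow> y0" "reach F S y0 x0" by blast
  have r: "strict_mono (r1 \<circ> r2)" using r1 r2 by (auto intro: strict_mono_o)
  have "S \<le> t0"
    by (rule LIMSEQ_le[OF r1(2) LIMSEQ_subseq_LIMSEQ[OF lim(1) r1(1)]]) (use sy(1) in auto)
  moreover have "infdist y0 Xo \<le> c0"
  proof (rule LIMSEQ_le)
    show "(\<lambda>k. infdist ((y \<circ> r1 \<circ> r2) k) Xo) \<longlonglongrightarrow> infdist y0 Xo"
      by (rule tendsto_infdist[OF r2(2)])
    show "(c \<circ> (r1 \<circ> r2)) \<longlonglongrightarrow> c0" by (rule LIMSEQ_subseq_LIMSEQ[OF lim(3) r])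
    show "\<exists>N. \<forall>n\<ge>N. infdist ((y \<circ> r1 \<circ> r2) n) Xo \<le> (c \<circ> (r1 \<circ> r2)) n"
      using sy(3) by (auto intro: less_imp_le)
  qed
  ultimately show ?thesis using that r2(3) by blast
qed

text \<open>Constant sequences with thresholds \<open>1 / real (Suc k)\<close> turn infimum zero
  into an arc whose starting point has distance zero from \<open>Xo\<close>; closedness and
  nonemptiness of \<open>Xo\<close> place that point in \<open>Xo\<close>.\<close>

lemma reach_barrier_nonpos_iff:
  fixes F :: "'a::euclidean_space \<Rightarrow> 'a set"
  assumes F: "usc_setvalued F" "\<And>x. compact (F x)" "\<And>x. convex (F x)" "backward_complete F"
    and Xo: "closed Xo" "Xo \<noteq> {}" and t: "0 \<le> t"
  shows "reach_barrier F Xo (t, x) \<le> 0 \<longleftrightarrow> (\<exists>s y. s \<le> t \<and> reach F s y x \<and> y \<in> Xo)"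
proof
  assume le: "reach_barrier F Xo (t, x) \<le> 0"
  have "reach_barrier F Xo (t, x) < 1 / real (Suc k)" for k
    using le by (rule order_le_less_trans) simp
  from reach_barrier_limit[OF F tendsto_const tendsto_const LIMSEQ_inverse_real_of_nat[unfolded inverse_eq_divide] t this]
  obtain s y where sy: "s \<le> t" "reach F s y x" "infdist y Xo \<le> 0" by blast
  then have "infdist y Xo = 0" using infdist_nonneg[of y Xo] by simp
  then have "y \<in> Xo" using in_closed_iff_infdist_zero[OF Xo] by simp
  with sy show "\<exists>s y. s \<le> t \<and> reach F s y x \<and> y \<in> Xo" by blast
next
  assume "\<exists>s y. s \<le> t \<and> reach F s y x \<and> y \<in> Xo"
  then show "reach_barrier F Xo (t, x) \<le> 0"
    using reach_barrier_le[of F _ _ x t Xo] by force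
qed

lemma reach_barrier_lsc:
  fixes F :: "'a::euclidean_space \<Rightarrow> 'a set"
  assumes F: "usc_setvalued F" "\<And>x. compact (F x)" "\<And>x. convex (F x)" "backward_complete F"
  shows "lsc_on ext_space (reach_barrier F Xo)"
  unfolding lsc_on_def
proof (intro ballI allI impI, rule ccontr)
  fix p :: "real \<times> 'a" and \<epsilon> :: real
  let ?B = "reach_barrier F Xo"
  assume p: "p \<in> ext_space" and e: "\<epsilon> > 0"
    and "\<not> (\<forall>\<^sub>F q in at p within ext_space. ?B p - \<epsilon> < ?B q)"
  then have "\<exists>q\<in>ext_space. dist q p < 1 / real (Suc k) \<and> ?B q \<le> ?B p - \<epsilon>" for k
    unfolding eventually_at by (metis not_less of_nat_0_less_iff zero_less_Suc zero_less_divide_1_iff)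
  then obtain q where q: "\<And>k. q k \<in> ext_space" "\<And>k. dist (q k) p < 1 / real (Suc k)"
      "\<And>k. ?B (q k) \<le> ?B p - \<epsilon>" by metis
  have "q \<longlonglongrightarrow> p"
  proof -
    have inv: "(\<lambda>k. 1 / real (Suc k)) \<longlonglongrightarrow> 0"
      using LIMSEQ_inverse_real_of_nat by (simp add: inverse_eq_divide)
    have "(\<lambda>k. dist (q k) p) \<longlonglongrightarrow> 0"
      by (rule tendsto_sandwich[OF _ _ tendsto_const inv])
         (use q(2) in \<open>simp_all add: less_imp_le\<close>)
    then show ?thesis by (rule iffD2[OF tendsto_dist_iff])
  qed
  then have lim: "(\<lambda>k. fst (q k)) \<longlonglongrightarrow> fst p" "(\<lambda>k. snd (q k)) \<longlonglongrightarrow> snd p"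
    by (auto intro: tendsto_fst tendsto_snd)
  have nonneg: "0 \<le> fst (q k)" for k using q(1)[of k] by (auto simp: ext_space_def)
  \<comment> \<open>Halving \<open>\<epsilon>\<close> makes the inequality strict, as the limit
    argument expects, and still leaves a drop below the value at \<open>p\<close>.\<close>
  have less: "?B (fst (q k), snd (q k)) < ?B p - \<epsilon> / 2" for k using q(3)[of k] e by simp
  obtain s y where sy: "s \<le> fst p" "reach F s y (snd p)" "infdist y Xo \<le> ?B p - \<epsilon> / 2"
    using reach_barrier_limit[OF F lim tendsto_const nonneg less] by blast
  from reach_barrier_le[OF sy(2,1), of Xo] sy(3) e show False by simp
qed

text \<open>The lower estimate is joint lower semicontinuity at fixed \<open>x\<close>. For the
  upper one a near-minimal arc has to fit into slightly less time; its starting point then moves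
  continuously along it, and so does the distance to \<open>Xo\<close>.\<close>

lemma reach_barrier_continuous:
  fixes F :: "'a::euclidean_space \<Rightarrow> 'a set"
  assumes F: "usc_setvalued F" "\<And>x. compact (F x)" "\<And>x. convex (F x)" "backward_complete F"
  shows "continuous_on {0..} (\<lambda>t. reach_barrier F Xo (t, x))"
  unfolding continuous_on_def
proof (rule ballI, rule order_tendstoI)
  fix t a :: real
  let ?B = "reach_barrier F Xo"
  assume t: "t \<in> {0..}"
  {
    assume a: "a < ?B (t, x)"
    define e where "e = ?B (t, x) - a"
    have "e > 0" using a by (simp add: e_def)
    then have "\<forall>\<^sub>F q in at (t, x) within ext_space. ?B (t, x) - e < ?B q"
      using reach_barrier_lsc[OF F, of Xo] t by (auto simp: lsc_on_def ext_space_def)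
    then obtain d where "d > 0" and d: "\<And>q. q \<in> ext_space \<Longrightarrow> q \<noteq> (t, x) \<Longrightarrow> dist q (t, x) < d \<Longrightarrow> a < ?B q"
      unfolding eventually_at by (auto simp: e_def)
    then show "\<forall>\<^sub>F t' in at t within {0..}. a < ?B (t', x)"
      unfolding eventually_at
      by (intro exI[of _ d]) (auto simp: ext_space_def dist_Pair_Pair)
  next
    assume a: "?B (t, x) < a"
    obtain s y where sy: "s \<le> t" "reach F s y x" "infdist y Xo < a"
      using reach_barrier_lessD[OF a] t by auto
    then obtain \<phi> where \<phi>: "trajectory F 0 s \<phi>" "\<phi> 0 = y" "\<phi> s = x" "0 \<le> s"
      by (auto simp: reach_def)
    have cont: "continuous_on {0..s} \<phi>"
      using \<phi>(1) by (auto simp: trajectory_def intro: abs_cont_on_imp_continuous_on)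
    \<comment> \<open>For times \<open>t'\<close> below \<open>s\<close> the trajectory is cut at its start to shorten it to length \<open>t'\<close>.\<close>
    define u where "u t' = max 0 (s - t')" for t'
    have "continuous_on {0..} (\<lambda>t'. infdist (\<phi> (u t')) Xo)"
      using \<phi>(4) by (intro continuous_on_infdist continuous_on_compose2[OF cont])
        (auto simp: u_def intro!: continuous_intros)
    then have "((\<lambda>t'. infdist (\<phi> (u t')) Xo) \<longlongrightarrow> infdist (\<phi> (u t)) Xo) (at t within {0..})"
      using t by (auto simp: continuous_on_def)
    moreover have "u t = 0" using sy(1) by (simp add: u_def)
    ultimately have "\<forall>\<^sub>F t' in at t within {0..}. infdist (\<phi> (u t')) Xo < a"
      using sy(3) \<phi>(2) by (intro order_tendstoD(2)) auto
    moreover have "\<forall>\<^sub>F t' in at t within {0..}. 0 \<le> t'"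
      by (auto simp: eventually_at_filter)
    ultimately show "\<forall>\<^sub>F t' in at t within {0..}. ?B (t', x) < a"
    proof eventually_elim
      case (elim t')
      have u: "0 \<le> u t'" "u t' \<le> s" using elim(2) \<phi>(4) by (auto simp: u_def)
      have "reach F (s - u t') (\<phi> (u t')) x"
        using trajectory_imp_reach[OF trajectory_subinterval[OF \<phi>(1) u(1) order_refl] u(2)] \<phi>(3) by simp
      moreover have "s - u t' \<le> t'" by (simp add: u_def)
      ultimately show ?case using elim(1) reach_barrier_le order_le_less_trans by blast
    qed
  }
qed

section \<open>The extended system and the equivalence\<close>

lemma trajectory_ext_sys_snd:
  assumes "trajectory (ext_sys F) a b \<psi>"
  shows "trajectory F a b (\<lambda>t. snd (\<psi> t))"
proof -
  obtain N where ac: "abs_cont_on a b \<psi>" and N: "negligible N"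
    "\<And>t. t \<in> {a<..<b} - N \<Longrightarrow> \<exists>v. (\<psi> has_vector_derivative v) (at t) \<and> v \<in> ext_sys F (\<psi> t)"
    using assms by (auto simp: trajectory_def)
  have le: "norm (snd z) \<le> norm z" for z :: "real \<times> 'a" by (metis norm_snd_le prod.collapse)
  have "abs_cont_on a b (\<lambda>t. snd (\<psi> t))"
  proof (rule abs_cont_on_compose[where \<sigma> = "\<lambda>x. x" and K = 0, OF ac])
    fix l r :: real assume "l \<le> r"
    then show "norm (snd (\<psi> r) - snd (\<psi> l)) \<le> 0 * (r - l) + norm (\<psi> (max l r) - \<psi> (min l r))"
      using le[of "\<psi> r - \<psi> l"]
      by (simp add: max_absorb2 min_absorb1)
  qed (simp_all add: mono_on_def)
  moreover have "\<exists>v. ((\<lambda>t. snd (\<psi> t)) has_vector_derivative v) (at t) \<and> v \<in> F (snd (\<psi> t))"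
    if "t \<in> {a<..<b} - N" for t
  proof -
    from N(2)[OF that] obtain v where
      v: "(\<psi> has_vector_derivative v) (at t)" "v \<in> ext_sys F (\<psi> t)" by blast
    from bounded_linear.has_vector_derivative[OF bounded_linear_snd v(1)] v(2)
    show ?thesis by (auto simp: ext_sys_def split: prod.splits)
  qed
  ultimately show ?thesis unfolding trajectory_def using N(1) by blast
qed

text \<open>All velocities lie in the closed convex set \<open>{1} \<times> UNIV\<close>, so the
  difference quotient does too, and its first component is exactly 1.\<close>

lemma trajectory_ext_sys_fst:
  assumes "trajectory (ext_sys F) a b \<psi>" "a \<le> b"
  shows "fst (\<psi> b) = fst (\<psi> a) + (b - a)"
proof (cases "a = b")
  case False
  then have "a < b" using assms(2) by simp
  have "(\<psi> b - \<psi> a) /\<^sub>R (b - a) \<in> {1} \<times> UNIV"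
    by (rule trajectory_difference_quotient[OF assms(1) \<open>a < b\<close>])
       (auto simp: closed_Times convex_Times ext_sys_def)
  then have "inverse (b - a) * (fst (\<psi> b) - fst (\<psi> a)) = 1" by (auto simp: mem_Times_iff)
  then show ?thesis using \<open>a < b\<close> by (simp add: field_simps)
qed simp

lemma trajectory_ext_sys_Pair:
  assumes "trajectory F a b \<phi>"
  shows "trajectory (ext_sys F) a b (\<lambda>t. (t + c, \<phi> t))"
proof -
  obtain N where ac: "abs_cont_on a b \<phi>" and N: "negligible N"
    "\<And>t. t \<in> {a<..<b} - N \<Longrightarrow> \<exists>v. (\<phi> has_vector_derivative v) (at t) \<and> v \<in> F (\<phi> t)"
    using assms by (auto simp: trajectory_def)
  have "abs_cont_on a b (\<lambda>t. (t + c, \<phi> t))"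
  proof (rule abs_cont_on_compose[where \<sigma> = "\<lambda>x. x" and K = 1, OF ac])
    fix l r :: real assume "l \<le> r"
    then show "norm ((r + c, \<phi> r) - (l + c, \<phi> l)) \<le> 1 * (r - l) + norm (\<phi> (max l r) - \<phi> (min l r))"
      using norm_Pair_le[of "r - l" "\<phi> r - \<phi> l"] by (simp add: max_absorb2 min_absorb1)
  qed (simp_all add: mono_on_def)
  moreover have "\<exists>v. ((\<lambda>t. (t + c, \<phi> t)) has_vector_derivative v) (at t) \<and> v \<in> ext_sys F (t + c, \<phi> t)"
    if "t \<in> {a<..<b} - N" for t
  proof -
    from N(2)[OF that] obtain v where v: "(\<phi> has_vector_derivative v) (at t)" "v \<in> F (\<phi> t)" by blast
    have "((\<lambda>t. t + c) has_vector_derivative 1) (at t)" by (auto intro!: derivative_eq_intros)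
    from has_vector_derivative_Pair[OF this v(1)] v(2) show ?thesis by (auto simp: ext_sys_def)
  qed
  ultimately show ?thesis unfolding trajectory_def using N(1) by blast
qed

text \<open>The whole extended space serves as the neighbourhood of the sublevel set.\<close>

lemma reach_barrier_prop_starstar: "prop_starstar F (reach_barrier F Xo)"
  unfolding prop_starstar_def
proof (intro exI[of _ ext_space] conjI allI impI ballI)
  show "openin (top_of_set ext_space) ext_space" by simp
  show "sublevel_K (reach_barrier F Xo) \<subseteq> ext_space" by (auto simp: sublevel_K_def ext_space_def)
next
  fix p0 D \<psi> I s1 s2
  let ?B = "reach_barrier F Xo"
  let ?W = "ext_space - top_of_set ext_space interior_of sublevel_K ?B"
  assume A: "is_solution (ext_sys F) p0 D \<psi> \<and> p0 \<in> ?W \<and> is_interval I \<and> 0 \<in> I \<and> I \<subseteq> D \<and> (\<forall>s\<in>I. \<psi> s \<in> ?W)"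
    and s: "s1 \<in> I" "s2 \<in> I" "s1 \<le> s2"
  then have D: "s1 \<in> D" "s2 \<in> D" "sol_domain D" "trajectory (ext_sys F) 0 s2 \<psi>"
    by (auto simp: is_solution_iff_trajectory)
  then have "0 \<le> s1" using sol_domain_Icc_subset(1) by blast
  then have tr: "trajectory (ext_sys F) s1 s2 \<psi>"
    by (rule trajectory_subinterval[OF D(4) _ order_refl])
  have "reach F (s2 - s1) (snd (\<psi> s1)) (snd (\<psi> s2))"
    using trajectory_imp_reach[OF trajectory_ext_sys_snd[OF tr] s(3)] .
  moreover have "0 \<le> fst (\<psi> s1)" using A s(1) by (auto simp: ext_space_def mem_Times_iff)
  ultimately have "?B (fst (\<psi> s1) + (s2 - s1), snd (\<psi> s2)) \<le> ?B (fst (\<psi> s1), snd (\<psi> s1))"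
    by (rule reach_barrier_antimono)
  then show "?B (\<psi> s2) \<le> ?B (\<psi> s1)"
    unfolding trajectory_ext_sys_fst[OF tr s(3), symmetric] by simp
qed

section \<open>From a barrier to safety\<close>

lemma barrier_imp_safe:
  fixes B :: "real \<times> 'a::euclidean_space \<Rightarrow> real"
  assumes cand: "barrier_candidate B Xo Xu" and lsc: "lsc_on ext_space B" and star: "prop_starstar F B"
  shows "safe F Xo Xu"
  unfolding safe_def
proof (intro ballI allI impI notI)
  fix x0 D \<phi> t
  assume x0: "x0 \<in> Xo" and sol: "is_solution F x0 D \<phi>" and t: "t \<in> D" and bad: "\<phi> t \<in> Xu"
  have tr: "trajectory F 0 t \<phi>" and \<phi>0: "\<phi> 0 = x0" and "sol_domain D"
    using sol t by (auto simp: is_solution_iff_trajectory)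
  then have t0: "0 \<le> t" using sol_domain_Icc_subset(1) t by blast
  define \<psi> where "\<psi> s = (s, \<phi> s)" for s
  have "continuous_on {0..t} \<phi>"
    using tr by (auto simp: trajectory_def intro: abs_cont_on_imp_continuous_on)
  then have cont: "continuous_on {0..t} \<psi>" unfolding \<psi>_def by (intro continuous_intros)
  have ext: "\<psi> s \<in> ext_space" if "0 \<le> s" for s using that by (simp add: \<psi>_def ext_space_def)
  \<comment> \<open>Relatively open sets are pulled back along the continuous arc. This is used
    three times: for positivity of \<open>B\<close> near a point, for the interior of the sublevel
    set, and for its neighbourhood \<open>U\<close>.\<close>
  have near: "\<exists>\<delta>>0. \<forall>s\<in>{0..t}. \<bar>s - s0\<bar> < \<delta> \<longrightarrow> \<psi> s \<in> W"
    if W: "openin (top_of_set ext_space) W" and s0: "s0 \<in> {0..t}" "\<psi> s0 \<in> W" for W s0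
  proof -
    obtain e where "e > 0" and e: "\<And>q. q \<in> ext_space \<Longrightarrow> dist q (\<psi> s0) < e \<Longrightarrow> q \<in> W"
      using W s0(2) unfolding openin_euclidean_subtopology_iff by blast
    obtain \<delta> where "\<delta> > 0" "\<And>s. s \<in> {0..t} \<Longrightarrow> dist s s0 < \<delta> \<Longrightarrow> dist (\<psi> s) (\<psi> s0) < e"
      using cont s0(1) \<open>e > 0\<close> unfolding continuous_on_iff by blast
    then show ?thesis using e ext by (intro exI[of _ \<delta>]) (auto simp: dist_real_def)
  qed
  define S where "S = {s \<in> {0..t}. B (\<psi> s) \<le> 0}"
  define \<tau> where "\<tau> = Sup S"
  have "0 \<in> S" using cand x0 \<phi>0 t0 by (auto simp: S_def \<psi>_def barrier_candidate_def)
  have bdd: "bdd_above S" by (auto simp: S_def intro!: bdd_aboveI[of _ t])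
  have up: "s \<le> \<tau>" if "s \<in> S" for s unfolding \<tau>_def using that bdd by (rule cSup_upper)
  have \<tau>: "0 \<le> \<tau>" "\<tau> \<le> t"
    using up[OF \<open>0 \<in> S\<close>] \<open>0 \<in> S\<close> by (auto simp: \<tau>_def S_def intro!: cSup_least)
  \<comment> \<open>Were the value positive, lower semicontinuity with \<open>\<epsilon>\<close>
    equal to that value would make \<open>B\<close> positive near \<open>\<psi> \<tau>\<close>,
    although points of \<open>S\<close> lie arbitrarily close to its supremum.\<close>
  have \<tau>B: "B (\<psi> \<tau>) \<le> 0"
  proof (rule ccontr)
    assume pos: "\<not> B (\<psi> \<tau>) \<le> 0"
    then have "\<forall>\<^sub>F q in at (\<psi> \<tau>) within ext_space. B (\<psi> \<tau>) - B (\<psi> \<tau>) < B q"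
      using lsc[unfolded lsc_on_def, rule_format, OF ext[OF \<tau>(1)], of "B (\<psi> \<tau>)"] by simp
    then obtain e where "e > 0"
      and e: "\<And>q. q \<in> ext_space \<Longrightarrow> q \<noteq> \<psi> \<tau> \<Longrightarrow> dist q (\<psi> \<tau>) < e \<Longrightarrow> 0 < B q"
      unfolding eventually_at by auto
    have "openin (top_of_set ext_space) (ext_space \<inter> ball (\<psi> \<tau>) e)"
      by (intro openin_open_Int) simp
    from near[OF this, of \<tau>] obtain \<delta> where "\<delta> > 0"
      and \<delta>: "\<And>s. s \<in> {0..t} \<Longrightarrow> \<bar>s - \<tau>\<bar> < \<delta> \<Longrightarrow> \<psi> s \<in> ext_space \<inter> ball (\<psi> \<tau>) e"
      using \<tau> ext \<open>e > 0\<close> by auto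
    have "\<tau> - \<delta> < Sup S" using \<open>\<delta> > 0\<close> by (simp add: \<tau>_def)
    then obtain s where s: "s \<in> S" "\<tau> - \<delta> < s" using less_cSupD[of S] \<open>0 \<in> S\<close> by blast
    then have "\<psi> s \<in> ext_space" "dist (\<psi> s) (\<psi> \<tau>) < e"
      using \<delta>[of s] up[OF s(1)] by (auto simp: S_def dist_commute)
    then have "0 < B (\<psi> s)" using e[of "\<psi> s"] pos by (cases "\<psi> s = \<psi> \<tau>") auto
    with s(1) show False by (simp add: S_def)
  qed
  have "B (\<psi> t) > 0" using cand bad t0 by (auto simp: \<psi>_def barrier_candidate_def)
  then have "\<tau> < t" using \<tau>B \<tau>(2) by (cases "\<tau> = t") auto
  have after: "B (\<psi> s) > 0" if "\<tau> < s" "s \<le> t" for s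
  proof (rule ccontr)
    assume "\<not> B (\<psi> s) > 0"
    then have "s \<in> S" using that \<tau> by (auto simp: S_def)
    from up[OF this] that show False by simp
  qed
  let ?K = "sublevel_K B"
  let ?Int = "top_of_set ext_space interior_of ?K"
  have IntK: "?Int \<subseteq> ?K" by (rule interior_of_subset)
  obtain U where U: "openin (top_of_set ext_space) U" "?K \<subseteq> U"
    and mono: "\<forall>p0 D \<psi> I. is_solution (ext_sys F) p0 D \<psi> \<and> p0 \<in> U - ?Int \<and> is_interval I \<and>
      0 \<in> I \<and> I \<subseteq> D \<and> (\<forall>s\<in>I. \<psi> s \<in> U - ?Int) \<longrightarrow>
      (\<forall>s1\<in>I. \<forall>s2\<in>I. s1 \<le> s2 \<longrightarrow> B (\<psi> s2) \<le> B (\<psi> s1))"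
    using star unfolding prop_starstar_def by (elim exE conjE)
  have notK: "\<psi> s \<notin> ?K" if "\<tau> < s" "s \<le> t" for s
    using after[OF that] by (simp add: sublevel_K_def \<psi>_def)
  have \<tau>U: "\<psi> \<tau> \<in> U" using U(2) \<tau>B \<tau>(1) by (auto simp: sublevel_K_def \<psi>_def)
  \<comment> \<open>From an interior point the arc would remain in the sublevel set for a while
    after \<open>\<tau>\<close>, against the choice of \<open>\<tau>\<close>.\<close>
  have notInt: "\<psi> \<tau> \<notin> ?Int"
  proof
    assume "\<psi> \<tau> \<in> ?Int"
    from near[OF openin_interior_of _ this] obtain \<delta> where "\<delta> > 0"
      and \<delta>: "\<And>s. s \<in> {0..t} \<Longrightarrow> \<bar>s - \<tau>\<bar> < \<delta> \<Longrightarrow> \<psi> s \<in> ?Int" using \<tau> by auto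
    define s where "s = min t (\<tau> + \<delta> / 2)"
    have s: "\<tau> < s" "s \<le> t" "s - \<tau> < \<delta>" using \<open>\<tau> < t\<close> \<open>\<delta> > 0\<close> by (auto simp: s_def)
    then have "\<psi> s \<in> ?Int" using \<tau> by (intro \<delta>) auto
    then have "\<psi> s \<in> ?K" using IntK by blast
    with notK[OF s(1,2)] show False by simp
  qed
  from near[OF U(1) _ \<tau>U] obtain \<delta> where "\<delta> > 0"
    and \<delta>: "\<And>s. s \<in> {0..t} \<Longrightarrow> \<bar>s - \<tau>\<bar> < \<delta> \<Longrightarrow> \<psi> s \<in> U" using \<tau> by auto
  define \<eta> where "\<eta> = min (t - \<tau>) (\<delta> / 2)"
  have \<eta>: "0 < \<eta>" "\<tau> + \<eta> \<le> t" "\<eta> < \<delta>" using \<open>\<tau> < t\<close> \<open>\<delta> > 0\<close> by (auto simp: \<eta>_def)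
  \<comment> \<open>Monotonicity is available only for solutions that start outside the interior at
    parameter 0. The arc is therefore translated to begin at \<open>\<psi> \<tau>\<close> itself,
    where \<open>B\<close> is nonpositive; the clock offset \<open>\<tau>\<close> preserves the
    actual time.\<close>
  have "trajectory F 0 (t - \<tau>) (\<lambda>s. \<phi> (s + \<tau>))"
    by (rule trajectory_shift) (use trajectory_subinterval[OF tr \<tau>(1) order_refl] in simp)
  from trajectory_ext_sys_Pair[OF this, of \<tau>]
  have sol': "is_solution (ext_sys F) (\<psi> \<tau>) {0..t - \<tau>} (\<lambda>s. \<psi> (s + \<tau>))"
    using \<tau> by (subst is_solution_Icc_iff) (auto simp: \<psi>_def)
  have stay: "\<psi> (s + \<tau>) \<in> U - ?Int" if "s \<in> {0..\<eta>}" for s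
  proof (cases "s = 0")
    case False
    then have s: "\<tau> < s + \<tau>" "s + \<tau> \<le> t" using that \<eta> by auto
    then have "\<psi> (s + \<tau>) \<in> U" using that \<eta> \<tau> by (intro \<delta>) auto
    moreover have "\<psi> (s + \<tau>) \<notin> ?Int" using notK[OF s] IntK by blast
    ultimately show ?thesis by blast
  qed (use \<tau>U notInt in simp)
  have "\<forall>s1\<in>{0..\<eta>}. \<forall>s2\<in>{0..\<eta>}. s1 \<le> s2 \<longrightarrow> B (\<psi> (s2 + \<tau>)) \<le> B (\<psi> (s1 + \<tau>))"
  proof (rule mono[THEN spec[of _ "\<psi> \<tau>"], THEN spec[of _ "{0..t - \<tau>}"],
        THEN spec[of _ "\<lambda>s. \<psi> (s + \<tau>)"], THEN spec[of _ "{0..\<eta>}"], THEN mp], intro conjI ballI)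
    show "{0..\<eta>} \<subseteq> {0..t - \<tau>}" using \<eta> by auto
  qed (use sol' \<tau>U notInt \<eta> stay in \<open>simp_all add: is_interval_cc\<close>)
  from this[rule_format, of 0 \<eta>] have "B (\<psi> (\<eta> + \<tau>)) \<le> B (\<psi> \<tau>)" using \<eta>(1) by simp
  then show False using after[of "\<eta> + \<tau>"] \<eta> \<tau>B by simp
qed

theorem theorem2:
  fixes F :: "'a::euclidean_space \<Rightarrow> 'a set"
    and Xo Xu :: "'a set"
  assumes "usc_setvalued F"
    and "\<And>x. compact (F x)"
    and "\<And>x. convex (F x)"
    and "backward_complete F"
    and "closed Xo"
    and "Xo \<inter> Xu = {}"
  shows "safe F Xo Xu \<longleftrightarrow>
    (\<exists>B :: real \<times> 'a \<Rightarrow> real.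
       barrier_candidate B Xo Xu \<and>
       lsc_on ext_space B \<and>
       (\<forall>x. continuous_on {0..} (\<lambda>t. B (t, x))) \<and>
       prop_starstar F B)"
proof
  assume safe: "safe F Xo Xu"
  note F = assms(1-4)
  show "\<exists>B :: real \<times> 'a \<Rightarrow> real. barrier_candidate B Xo Xu \<and> lsc_on ext_space B \<and>
      (\<forall>x. continuous_on {0..} (\<lambda>t. B (t, x))) \<and> prop_starstar F B"
  proof (cases "Xo = {}")
    case True
    \<comment> \<open>\<open>infdist\<close> to the empty set is \<open>0\<close>, so the reachability barrier would not be positive.\<close>
    have "sublevel_K (\<lambda>_. 1) = ({} :: (real \<times> 'a) set)" by (simp add: sublevel_K_def)
    \<comment> \<open>The sublevel set is empty, so the empty set is a neighbourhood of it and
      contains no starting point.\<close>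
    then have "prop_starstar F (\<lambda>_. 1)" unfolding prop_starstar_def by (intro exI[of _ "{}"]) simp
    with True show ?thesis
      by (intro exI[of _ "\<lambda>_. 1"]) (auto simp: barrier_candidate_def lsc_on_def)
  next
    case False
    have "barrier_candidate (reach_barrier F Xo) Xo Xu"
      unfolding barrier_candidate_def
    proof (intro conjI allI impI ballI)
      fix t :: real and x assume t: "t \<ge> 0" and x: "x \<in> Xu"
      show "reach_barrier F Xo (t, x) > 0"
      proof (rule ccontr)
        assume "\<not> ?thesis"
        then obtain s y where sy: "reach F s y x" "y \<in> Xo"
          using reach_barrier_nonpos_iff[OF F assms(5) False t, of x] by auto
        then obtain \<phi> where "is_solution F y {0..s} \<phi>" "\<phi> s = x" "0 \<le> s"
          by (auto simp: reach_def is_solution_Icc_iff)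
        then show False using safe sy(2) x unfolding safe_def by fastforce
      qed
    next
      fix t :: real and x assume t: "t \<ge> 0" and x: "x \<in> Xo"
      then show "reach_barrier F Xo (t, x) \<le> 0"
        using reach_barrier_nonpos_iff[OF F assms(5) False t, of x] reach_refl[of F x] by blast
    qed
    then show ?thesis
      using reach_barrier_lsc[OF F] reach_barrier_continuous[OF F] reach_barrier_prop_starstar by blast
  qed
next
  assume "\<exists>B :: real \<times> 'a \<Rightarrow> real. barrier_candidate B Xo Xu \<and> lsc_on ext_space B \<and>
      (\<forall>x. continuous_on {0..} (\<lambda>t. B (t, x))) \<and> prop_starstar F B"
  then obtain B :: "real \<times> 'a \<Rightarrow> real" where
    "barrier_candidate B Xo Xu" "lsc_on ext_space B" "prop_starstar F B" by blast
  then show "safe F Xo Xu" by (rule barrier_imp_safe)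
qed

end
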